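(* Let $\mathbf{tDL}$ be the category of tense distributive lattices with tense homomorphisms and $\mathbf{tPS}$ the category of tense Priestley spaces with $\mathbf{tPS}$-functions. The contravariant functors $\Psi:\mathbf{tPS}\to\mathbf{tDL}$ and $\Phi:\mathbf{tDL}\to\mathbf{tPS}$ described below establish that the categories $\mathbf{tPS}$ and $\mathbf{tDL}$ are naturally (dually) equivalent: the family $\{\sigma_A\}$ is a natural isomorphism from $\mathrm{Id}_{\mathbf{tDL}}$ to $\Psi\circ\Phi$ and the family $\{\varepsilon_X\}$ is a natural isomorphism from $\mathrm{Id}_{\mathbf{tPS}}$ to $\Phi\circ\Psi$.
   Context: A tense distributive lattice ($\mathbf{tDL}$-algebra) is $\mathcal{A}=\langle A,\wedge,\vee,0,1,\mathbf{G},\mathbf{H},\mathbf{F},\mathbf{P}\rangle$ where $\langle A,\wedge,\vee,0,1\rangle$ is a bounded distributive lattice and the unary operators satisfy, for all $x,y$: (t1) $\mathbf{G}1=1$, $\mathbf{H}1=1$; (t2) $\mathbf{G}(x\wedge y)=\mathbf{G}x\wedge\mathbf{G}y$, $\mathbf{H}(x\wedge y)=\mathbf{H}x\wedge\mathbf{H}y$; (t3) $x\le\mathbf{G}\mathbf{P}x$, $x\le\mathbf{H}\mathbf{F}x$; (t4) $\mathbf{G}(x\vee y)\le\mathbf{G}x\vee\mathbf{F}y$, $\mathbf{H}(x\vee y)\le\mathbf{H}x\vee\mathbf{P}y$; (t5) $\mathbf{F}0=0$, $\mathbf{P}0=0$; (t6) $\mathbf{F}(x\vee y)=\mathbf{F}x\vee\mathbf{F}y$,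 $\mathbf{P}(x\vee y)=\mathbf{P}x\vee\mathbf{P}y$; (t7) $\mathbf{P}\mathbf{G}x\le x$, $\mathbf{F}\mathbf{H}x\le x$; (t8) $\mathbf{G}x\wedge\mathbf{F}y\le\mathbf{F}(x\wedge y)$, $\mathbf{H}x\wedge\mathbf{P}y\le\mathbf{P}(x\wedge y)$. Morphisms of $\mathbf{tDL}$ are bounded lattice homomorphisms commuting with $\mathbf{G},\mathbf{H},\mathbf{F},\mathbf{P}$. For a set $X$ and binary relation $R$ on $X$ (with $R(x)=\{y:(x,y)\in R\}$, $R^{-1}(x)=\{y:(y,x)\in R\}$, and $R(Y)=\bigcup_{y\in Y}R(y)$), define for $Y\subseteq X$: $\mathbf{G}_R(Y)=\{x:R(x)\subseteq Y\}$, $\mathbf{F}_R(Y)=\{x:R(x)\cap Y\ne\emptyset\}$, $\mathbf{H}_{R^{-1}}(Y)=\{x:R^{-1}(x)\subseteq Y\}$, $\mathbf{P}_{R^{-1}}(Y)=\{x:R^{-1}(x)\cap Y\neq\emptyset\}$. A tense Priestley space is a pair $(X,R)$ where $X=(X,\le,\tau)$ is a Priestley space and $R$ a binary relation on $X$ such that: (tPS1) $R(x)$ is closed for every $x$; (tPS2) $R(x)={\uparrow}R(x)\cap{\downarrow}R(x)$ for every $x$; (tPS3) $\mathbf{G}_R(U),\mathbf{H}_{R^{-1}}(U),\mathbf{F}_R(U),\mathbf{P}_{R^{-1}}(U)\in D(X)$ for every $U\in D(X)$, where $D(X)$ is the set of clopen up-sets of $X$. A $\mathbf{tPS}$-function $f:(X_1,R_1)\to(X_2,R_2)$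 is a continuous order-preserving map such that (f1) $f(R_1(x))\subseteq R_2(f(x))$ for all $x\in X_1$; (f2) for all $x\in X_1,y\in X_2$, if $y\in R_2(f(x))$ then there are $z,w\in R_1(x)$ with $f(z)\le y\le f(w)$; (f3) for all $x\in X_1,y\in X_2$, if $y\in R_2^{-1}(f(x))$ then there are $z,w\in R_1^{-1}(x)$ with $f(z)\le y\le f(w)$. Functors: $\Psi(X,R)=\langle D(X),\cap,\cup,\emptyset,X,\mathbf{G}_R,\mathbf{H}_{R^{-1}},\mathbf{F}_R,\mathbf{P}_{R^{-1}}\rangle$ and $\Psi(f)(U)=f^{-1}(U)$. For a $\mathbf{tDL}$-algebra $\mathcal{A}$, $X(A)$ is the set of prime filters of the underlying lattice, ordered by inclusion, with the Priestley topology (generated by the sets $\sigma_A(a)=\{T\in X(A):a\in T\}$ and their complements), and $R_A$ is the relation $(S,T)\in R_A$ iff $\mathbf{G}^{-1}(S)\subseteq T\subseteq\mathbf{F}^{-1}(S)$ (where $\Phi^{-1}(S)=\{a:\Phi(a)\in S\}$); $\Phi(\mathcal{A})=(X(A),R_A)$ and $\Phi(h)(S)=h^{-1}(S)$. The maps are $\sigma_A:A\to D(X(A))$, $a\mapsto\sigma_A(a)$, and $\varepsilon_X:X\to X(D(X))$, $\varepsilon_X(x)=\{U\in D(X):x\in U\}$. *)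

theory Defs
  imports "HOL-Analysis.Analysis"
begin

section \<open>Tense distributive lattices\<close>

record 'a tense_lattice =
  carr :: "'a set"
  meet :: "'a \<Rightarrow> 'a \<Rightarrow> 'a"  (infixl "\<sqinter>\<index>" 70)
  join :: "'a \<Rightarrow> 'a \<Rightarrow> 'a"  (infixl "\<squnion>\<index>" 65)
  lzero :: 'a  ("\<zero>\<index>")
  lone :: 'a  ("\<one>\<index>")
  opG :: "'a \<Rightarrow> 'a"
  opH :: "'a \<Rightarrow> 'a"
  opF :: "'a \<Rightarrow> 'a"
  opP :: "'a \<Rightarrow> 'a"

definition lle :: "('a, 'm) tense_lattice_scheme \<Rightarrow> 'a \<Rightarrow> 'a \<Rightarrow> bool"  (infix "\<sqsubseteq>\<index>" 50)
  where "lle A x y \<longleftrightarrow> meet A x y = x"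

text \<open>The one-element lattice is admitted (no axiom \<open>\<zero> \<noteq> \<one>\<close>); it is dual to the empty space.\<close>

locale bounded_distrib_lattice =
  fixes A :: "('a, 'm) tense_lattice_scheme" (structure)
  assumes meet_closed: "\<lbrakk>x \<in> carr A; y \<in> carr A\<rbrakk> \<Longrightarrow> x \<sqinter> y \<in> carr A"
    and join_closed: "\<lbrakk>x \<in> carr A; y \<in> carr A\<rbrakk> \<Longrightarrow> x \<squnion> y \<in> carr A"
    and zero_closed: "\<zero> \<in> carr A"
    and one_closed: "\<one> \<in> carr A"
    and meet_assoc: "\<lbrakk>x \<in> carr A; y \<in> carr A; z \<in> carr A\<rbrakk> \<Longrightarrow> (x \<sqinter> y) \<sqinter> z = x \<sqinter> (y \<sqinter> z)"
    and join_assoc: "\<lbrakk>x \<in> carr A; y \<in> carr A; z \<in> carr A\<rbrakk> \<Longrightarrow> (x \<squnion> y) \<squnion> z = x \<squnion> (y \<squnion> z)"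
    and meet_comm: "\<lbrakk>x \<in> carr A; y \<in> carr A\<rbrakk> \<Longrightarrow> x \<sqinter> y = y \<sqinter> x"
    and join_comm: "\<lbrakk>x \<in> carr A; y \<in> carr A\<rbrakk> \<Longrightarrow> x \<squnion> y = y \<squnion> x"
    and meet_absorb: "\<lbrakk>x \<in> carr A; y \<in> carr A\<rbrakk> \<Longrightarrow> x \<sqinter> (x \<squnion> y) = x"
    and join_absorb: "\<lbrakk>x \<in> carr A; y \<in> carr A\<rbrakk> \<Longrightarrow> x \<squnion> (x \<sqinter> y) = x"
    and meet_join_distrib:
      "\<lbrakk>x \<in> carr A; y \<in> carr A; z \<in> carr A\<rbrakk> \<Longrightarrow> x \<sqinter> (y \<squnion> z) = (x \<sqinter> y) \<squnion> (x \<sqinter> z)"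
    and zero_least: "x \<in> carr A \<Longrightarrow> \<zero> \<sqsubseteq> x"
    and one_greatest: "x \<in> carr A \<Longrightarrow> x \<sqsubseteq> \<one>"

locale tDL = bounded_distrib_lattice A
  for A :: "('a, 'm) tense_lattice_scheme" (structure) +
  assumes G_closed: "x \<in> carr A \<Longrightarrow> opG A x \<in> carr A"
    and H_closed: "x \<in> carr A \<Longrightarrow> opH A x \<in> carr A"
    and F_closed: "x \<in> carr A \<Longrightarrow> opF A x \<in> carr A"
    and P_closed: "x \<in> carr A \<Longrightarrow> opP A x \<in> carr A"
    and t1: "opG A \<one> = \<one>" "opH A \<one> = \<one>"
    and t2: "\<lbrakk>x \<in> carr A; y \<in> carr A\<rbrakk> \<Longrightarrow> opG A (x \<sqinter> y) = opG A x \<sqinter> opG A y"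
            "\<lbrakk>x \<in> carr A; y \<in> carr A\<rbrakk> \<Longrightarrow> opH A (x \<sqinter> y) = opH A x \<sqinter> opH A y"
    and t3: "x \<in> carr A \<Longrightarrow> x \<sqsubseteq> opG A (opP A x)"
            "x \<in> carr A \<Longrightarrow> x \<sqsubseteq> opH A (opF A x)"
    and t4: "\<lbrakk>x \<in> carr A; y \<in> carr A\<rbrakk> \<Longrightarrow> opG A (x \<squnion> y) \<sqsubseteq> opG A x \<squnion> opF A y"
            "\<lbrakk>x \<in> carr A; y \<in> carr A\<rbrakk> \<Longrightarrow> opH A (x \<squnion> y) \<sqsubseteq> opH A x \<squnion> opP A y"
    and t5: "opF A \<zero> = \<zero>" "opP A \<zero> = \<zero>"
    and t6: "\<lbrakk>x \<in> carr A; y \<in> carr A\<rbrakk> \<Longrightarrow> opF A (x \<squnion> y) = opF A x \<squnion> opF A y"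
            "\<lbrakk>x \<in> carr A; y \<in> carr A\<rbrakk> \<Longrightarrow> opP A (x \<squnion> y) = opP A x \<squnion> opP A y"
    and t7: "x \<in> carr A \<Longrightarrow> opP A (opG A x) \<sqsubseteq> x"
            "x \<in> carr A \<Longrightarrow> opF A (opH A x) \<sqsubseteq> x"
    and t8: "\<lbrakk>x \<in> carr A; y \<in> carr A\<rbrakk> \<Longrightarrow> opG A x \<sqinter> opF A y \<sqsubseteq> opF A (x \<sqinter> y)"
            "\<lbrakk>x \<in> carr A; y \<in> carr A\<rbrakk> \<Longrightarrow> opH A x \<sqinter> opP A y \<sqsubseteq> opP A (x \<sqinter> y)"

text \<open>
  In both categories a morphism is an extensional function on the carrier of its source
  (\<open>undefined\<close> elsewhere), so that equality of morphisms is equality in HOL, composition is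
  \<^const>\<open>compose\<close> on the carrier of the source, and the identity is \<open>\<lambda>x\<in>S. x\<close>.
\<close>

definition tDL_hom :: "'a tense_lattice \<Rightarrow> 'b tense_lattice \<Rightarrow> ('a \<Rightarrow> 'b) set" where
  "tDL_hom A B = {h \<in> carr A \<rightarrow>\<^sub>E carr B.
     (\<forall>x\<in>carr A. \<forall>y\<in>carr A. h (meet A x y) = meet B (h x) (h y)) \<and>
     (\<forall>x\<in>carr A. \<forall>y\<in>carr A. h (join A x y) = join B (h x) (h y)) \<and>
     h (lzero A) = lzero B \<and> h (lone A) = lone B \<and>
     (\<forall>x\<in>carr A. h (opG A x) = opG B (h x)) \<and>
     (\<forall>x\<in>carr A. h (opH A x) = opH B (h x)) \<and>
     (\<forall>x\<in>carr A. h (opF A x) = opF B (h x)) \<and>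
     (\<forall>x\<in>carr A. h (opP A x) = opP B (h x))}"

definition tDL_id :: "'a tense_lattice \<Rightarrow> 'a \<Rightarrow> 'a" where
  "tDL_id A = (\<lambda>x\<in>carr A. x)"

definition tDL_comp :: "'a tense_lattice \<Rightarrow> ('b \<Rightarrow> 'c) \<Rightarrow> ('a \<Rightarrow> 'b) \<Rightarrow> 'a \<Rightarrow> 'c" where
  "tDL_comp A g h = compose (carr A) g h"

definition tDL_iso :: "'a tense_lattice \<Rightarrow> 'b tense_lattice \<Rightarrow> ('a \<Rightarrow> 'b) set" where
  "tDL_iso A B = {h \<in> tDL_hom A B.
     \<exists>g \<in> tDL_hom B A. tDL_comp A g h = tDL_id A \<and> tDL_comp B h g = tDL_id B}"


section \<open>Tense Priestley spaces\<close>

text \<open>The underlying set is \<open>topspace (topo X)\<close>; \<open>(x, y) \<in> leq X\<close> means \<open>x \<le> y\<close>.\<close>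

record 'x tense_space =
  topo :: "'x topology"
  leq :: "('x \<times> 'x) set"
  rel :: "('x \<times> 'x) set"

abbreviation pts :: "('x, 'm) tense_space_scheme \<Rightarrow> 'x set" where
  "pts X \<equiv> topspace (topo X)"

definition upset :: "('x, 'm) tense_space_scheme \<Rightarrow> 'x set \<Rightarrow> bool" where
  "upset X U \<longleftrightarrow> U \<subseteq> pts X \<and> (\<forall>x y. x \<in> U \<and> (x, y) \<in> leq X \<longrightarrow> y \<in> U)"

definition clopen_upsets :: "('x, 'm) tense_space_scheme \<Rightarrow> 'x set set" where
  "clopen_upsets X = {U. openin (topo X) U \<and> closedin (topo X) U \<and> upset X U}"

text \<open>The operators of a relation \<open>R\<close> on a set \<open>S\<close>, taking subsets of \<open>S\<close> to subsets of \<open>S\<close>;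
  \<open>H_op S R\<close> and \<open>P_op S R\<close> are the operators subscripted by \<open>R\<^sup>-\<^sup>1\<close> in the literature.\<close>

definition G_op :: "'x set \<Rightarrow> ('x \<times> 'x) set \<Rightarrow> 'x set \<Rightarrow> 'x set" where
  "G_op S R Y = {x \<in> S. R `` {x} \<subseteq> Y}"

definition F_op :: "'x set \<Rightarrow> ('x \<times> 'x) set \<Rightarrow> 'x set \<Rightarrow> 'x set" where
  "F_op S R Y = {x \<in> S. R `` {x} \<inter> Y \<noteq> {}}"

definition H_op :: "'x set \<Rightarrow> ('x \<times> 'x) set \<Rightarrow> 'x set \<Rightarrow> 'x set" where
  "H_op S R Y = {x \<in> S. R\<inverse> `` {x} \<subseteq> Y}"

definition P_op :: "'x set \<Rightarrow> ('x \<times> 'x) set \<Rightarrow> 'x set \<Rightarrow> 'x set" where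
  "P_op S R Y = {x \<in> S. R\<inverse> `` {x} \<inter> Y \<noteq> {}}"

locale priestley_space =
  fixes X :: "('x, 'm) tense_space_scheme"
  assumes compact: "compact_space (topo X)"
    and partial_order: "partial_order_on (pts X) (leq X)"
    and separation: "\<lbrakk>x \<in> pts X; y \<in> pts X; (x, y) \<notin> leq X\<rbrakk>
      \<Longrightarrow> \<exists>U \<in> clopen_upsets X. x \<in> U \<and> y \<notin> U"

locale tPS = priestley_space X for X :: "('x, 'm) tense_space_scheme" +
  assumes rel_on: "rel X \<subseteq> pts X \<times> pts X"
    and tPS1: "x \<in> pts X \<Longrightarrow> closedin (topo X) (rel X `` {x})"
    and tPS2: "x \<in> pts X \<Longrightarrow>
      rel X `` {x} = leq X `` (rel X `` {x}) \<inter> (leq X)\<inverse> `` (rel X `` {x})"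
    and tPS3: "U \<in> clopen_upsets X \<Longrightarrow> G_op (pts X) (rel X) U \<in> clopen_upsets X"
              "U \<in> clopen_upsets X \<Longrightarrow> H_op (pts X) (rel X) U \<in> clopen_upsets X"
              "U \<in> clopen_upsets X \<Longrightarrow> F_op (pts X) (rel X) U \<in> clopen_upsets X"
              "U \<in> clopen_upsets X \<Longrightarrow> P_op (pts X) (rel X) U \<in> clopen_upsets X"

definition tPS_hom :: "'x tense_space \<Rightarrow> 'y tense_space \<Rightarrow> ('x \<Rightarrow> 'y) set" where
  "tPS_hom X Y = {f \<in> pts X \<rightarrow>\<^sub>E pts Y.
     continuous_map (topo X) (topo Y) f \<and>
     (\<forall>x y. (x, y) \<in> leq X \<longrightarrow> (f x, f y) \<in> leq Y) \<and>
     (\<forall>x\<in>pts X. f ` (rel X `` {x}) \<subseteq> rel Y `` {f x}) \<and>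
     (\<forall>x\<in>pts X. \<forall>y\<in>pts Y. y \<in> rel Y `` {f x} \<longrightarrow>
        (\<exists>z\<in>rel X `` {x}. \<exists>w\<in>rel X `` {x}. (f z, y) \<in> leq Y \<and> (y, f w) \<in> leq Y)) \<and>
     (\<forall>x\<in>pts X. \<forall>y\<in>pts Y. y \<in> (rel Y)\<inverse> `` {f x} \<longrightarrow>
        (\<exists>z\<in>(rel X)\<inverse> `` {x}. \<exists>w\<in>(rel X)\<inverse> `` {x}. (f z, y) \<in> leq Y \<and> (y, f w) \<in> leq Y))}"

definition tPS_id :: "'x tense_space \<Rightarrow> 'x \<Rightarrow> 'x" where
  "tPS_id X = (\<lambda>x\<in>pts X. x)"

definition tPS_comp :: "'x tense_space \<Rightarrow> ('y \<Rightarrow> 'z) \<Rightarrow> ('x \<Rightarrow> 'y) \<Rightarrow> 'x \<Rightarrow> 'z" where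
  "tPS_comp X g f = compose (pts X) g f"

definition tPS_iso :: "'x tense_space \<Rightarrow> 'y tense_space \<Rightarrow> ('x \<Rightarrow> 'y) set" where
  "tPS_iso X Y = {f \<in> tPS_hom X Y.
     \<exists>g \<in> tPS_hom Y X. tPS_comp X g f = tPS_id X \<and> tPS_comp Y f g = tPS_id Y}"


section \<open>The category laws\<close>

lemma tDL_id_hom:
  assumes "tDL A" shows "tDL_id A \<in> tDL_hom A A"
proof -
  interpret tDL A by fact
  show ?thesis
    by (auto simp: tDL_hom_def tDL_id_def meet_closed join_closed zero_closed one_closed
        G_closed H_closed F_closed P_closed)
qed

lemma tDL_comp_hom:
  assumes "tDL A" "h \<in> tDL_hom A B" "g \<in> tDL_hom B C"
  shows "tDL_comp A g h \<in> tDL_hom A C"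
proof -
  interpret tDL A by fact
  have "h x \<in> carr B" if "x \<in> carr A" for x
    using that assms(2) by (auto simp: tDL_hom_def)
  then show ?thesis
    using assms(2,3)
    by (auto simp: tDL_hom_def tDL_comp_def compose_def meet_closed join_closed zero_closed
        one_closed G_closed H_closed F_closed P_closed)
qed

lemma tDL_category_laws:
  assumes "h \<in> tDL_hom A B" "g \<in> tDL_hom B C" "k \<in> tDL_hom C D"
  shows "tDL_comp A h (tDL_id A) = h" "tDL_comp A (tDL_id B) h = h"
    and "tDL_comp A k (tDL_comp A g h) = tDL_comp A (tDL_comp B k g) h"
  using assms
  by (auto simp: tDL_hom_def tDL_comp_def tDL_id_def PiE_iff compose_def restrict_def
      extensional_def fun_eq_iff)

lemma tPS_id_hom:
  assumes "tPS X" shows "tPS_id X \<in> tPS_hom X X"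
proof -
  interpret tPS X by fact
  have leq: "(x, y) \<in> leq X \<Longrightarrow> x \<in> pts X \<and> y \<in> pts X" for x y
    using partial_order by (auto simp: order_on_defs)
  have refl: "x \<in> pts X \<Longrightarrow> (x, x) \<in> leq X" for x
    using partial_order by (auto simp: order_on_defs refl_on_def)
  have "continuous_map (topo X) (topo X) (tPS_id X)"
    by (rule continuous_map_eq[OF continuous_map_id]) (simp add: tPS_id_def)
  then show ?thesis
    using rel_on leq refl by (fastforce simp: tPS_hom_def tPS_id_def)
qed

lemma tPS_hom_f1:
  assumes "f \<in> tPS_hom X Y" "x \<in> pts X" "(x, y) \<in> rel X"
  shows "(f x, f y) \<in> rel Y"
proof -
  have "\<forall>x\<in>pts X. f ` (rel X `` {x}) \<subseteq> rel Y `` {f x}"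
    using assms(1) unfolding tPS_hom_def by blast
  then show ?thesis using assms(2,3) by blast
qed

lemma tPS_hom_f2:
  assumes "f \<in> tPS_hom X Y" "x \<in> pts X" "y \<in> pts Y" "(f x, y) \<in> rel Y"
  shows "\<exists>z w. (x, z) \<in> rel X \<and> (x, w) \<in> rel X \<and> (f z, y) \<in> leq Y \<and> (y, f w) \<in> leq Y"
proof -
  have "\<forall>x\<in>pts X. \<forall>y\<in>pts Y. y \<in> rel Y `` {f x} \<longrightarrow>
      (\<exists>z\<in>rel X `` {x}. \<exists>w\<in>rel X `` {x}. (f z, y) \<in> leq Y \<and> (y, f w) \<in> leq Y)"
    using assms(1) unfolding tPS_hom_def by blast
  then show ?thesis using assms(2-4) by blast
qed

lemma tPS_hom_f3:
  assumes "f \<in> tPS_hom X Y" "x \<in> pts X" "y \<in> pts Y" "(y, f x) \<in> rel Y"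
  shows "\<exists>z w. (z, x) \<in> rel X \<and> (w, x) \<in> rel X \<and> (f z, y) \<in> leq Y \<and> (y, f w) \<in> leq Y"
proof -
  have "\<forall>x\<in>pts X. \<forall>y\<in>pts Y. y \<in> (rel Y)\<inverse> `` {f x} \<longrightarrow>
      (\<exists>z\<in>(rel X)\<inverse> `` {x}. \<exists>w\<in>(rel X)\<inverse> `` {x}. (f z, y) \<in> leq Y \<and> (y, f w) \<in> leq Y)"
    using assms(1) unfolding tPS_hom_def by blast
  then show ?thesis using assms(2-4) by blast
qed

lemma tPS_comp_hom:
  assumes X: "tPS X" and Z: "tPS Z"
    and f: "f \<in> tPS_hom X Y" and g: "g \<in> tPS_hom Y Z" and Y: "tPS Y"
  shows "tPS_comp X g f \<in> tPS_hom X Z"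
proof -
  interpret X: tPS X by fact
  interpret Y: tPS Y by fact
  interpret Z: tPS Z by fact
  have leqX: "(x, y) \<in> leq X \<Longrightarrow> x \<in> pts X \<and> y \<in> pts X" for x y
    using X.partial_order by (auto simp: order_on_defs)
  have relX: "(x, y) \<in> rel X \<Longrightarrow> x \<in> pts X \<and> y \<in> pts X" for x y
    using X.rel_on by auto
  have relY: "(x, y) \<in> rel Y \<Longrightarrow> x \<in> pts Y \<and> y \<in> pts Y" for x y
    using Y.rel_on by auto
  have tr: "(x, y) \<in> leq Z \<Longrightarrow> (y, z) \<in> leq Z \<Longrightarrow> (x, z) \<in> leq Z" for x y z
    using Z.partial_order by (auto simp: order_on_defs elim: transE)
  have fX: "x \<in> pts X \<Longrightarrow> f x \<in> pts Y" for x
    using f by (auto simp: tPS_hom_def)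
  have gY: "y \<in> pts Y \<Longrightarrow> g y \<in> pts Z" for y
    using g by (auto simp: tPS_hom_def)
  have gle: "(x, y) \<in> leq Y \<Longrightarrow> (g x, g y) \<in> leq Z" for x y
    using g by (auto simp: tPS_hom_def)
  have cont: "continuous_map (topo X) (topo Z) (tPS_comp X g f)"
    using f g continuous_map_compose[of "topo X" "topo Y" f "topo Z" g]
    by (auto simp: tPS_hom_def tPS_comp_def compose_def intro: continuous_map_eq)
  have f2: "\<exists>z w. (x, z) \<in> rel X \<and> (x, w) \<in> rel X \<and> (g (f z), y) \<in> leq Z \<and> (y, g (f w)) \<in> leq Z"
    if xy: "x \<in> pts X" "y \<in> pts Z" "(g (f x), y) \<in> rel Z" for x y
  proof -
    obtain z w where zw: "(f x, z) \<in> rel Y" "(f x, w) \<in> rel Y" "(g z, y) \<in> leq Z" "(y, g w) \<in> leq Z"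
      using tPS_hom_f2[OF g fX[OF xy(1)] xy(2,3)] by blast
    obtain z' where "(x, z') \<in> rel X" "(f z', z) \<in> leq Y"
      using tPS_hom_f2[OF f xy(1) _ zw(1)] relY[OF zw(1)] by blast
    moreover obtain w' where "(x, w') \<in> rel X" "(w, f w') \<in> leq Y"
      using tPS_hom_f2[OF f xy(1) _ zw(2)] relY[OF zw(2)] by blast
    ultimately show ?thesis
      using gle tr zw(3,4) by blast
  qed
  have f3: "\<exists>z w. (z, x) \<in> rel X \<and> (w, x) \<in> rel X \<and> (g (f z), y) \<in> leq Z \<and> (y, g (f w)) \<in> leq Z"
    if xy: "x \<in> pts X" "y \<in> pts Z" "(y, g (f x)) \<in> rel Z" for x y
  proof -
    obtain z w where zw: "(z, f x) \<in> rel Y" "(w, f x) \<in> rel Y" "(g z, y) \<in> leq Z" "(y, g w) \<in> leq Z"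
      using tPS_hom_f3[OF g fX[OF xy(1)] xy(2,3)] by blast
    obtain z' where "(z', x) \<in> rel X" "(f z', z) \<in> leq Y"
      using tPS_hom_f3[OF f xy(1) _ zw(1)] relY[OF zw(1)] by blast
    moreover obtain w' where "(w', x) \<in> rel X" "(w, f w') \<in> leq Y"
      using tPS_hom_f3[OF f xy(1) _ zw(2)] relY[OF zw(2)] by blast
    ultimately show ?thesis
      using gle tr zw(3,4) by blast
  qed
  have eq: "x \<in> pts X \<Longrightarrow> tPS_comp X g f x = g (f x)" for x
    by (simp add: tPS_comp_def compose_def)
  have mono: "(tPS_comp X g f x, tPS_comp X g f y) \<in> leq Z" if "(x, y) \<in> leq X" for x y
    using that leqX[OF that] f gle by (simp add: eq tPS_hom_def)
  have f1: "(tPS_comp X g f x, tPS_comp X g f y) \<in> rel Z" if "(x, y) \<in> rel X" for x y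
  proof -
    have "(f x, f y) \<in> rel Y" using tPS_hom_f1[OF f] that relX[OF that] by blast
    then have "(g (f x), g (f y)) \<in> rel Z" using tPS_hom_f1[OF g] relY by blast
    then show ?thesis using relX[OF that] by (simp add: eq)
  qed
  have "tPS_comp X g f \<in> pts X \<rightarrow>\<^sub>E pts Z"
    using fX gY by (auto simp: tPS_comp_def compose_def)
  moreover have "\<exists>z\<in>rel X `` {x}. \<exists>w\<in>rel X `` {x}.
      (tPS_comp X g f z, y) \<in> leq Z \<and> (y, tPS_comp X g f w) \<in> leq Z"
    if "x \<in> pts X" "y \<in> pts Z" "y \<in> rel Z `` {tPS_comp X g f x}" for x y
    using f2[of x y] that relX by (metis Image_singleton_iff eq)
  moreover have "\<exists>z\<in>(rel X)\<inverse> `` {x}. \<exists>w\<in>(rel X)\<inverse> `` {x}.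
      (tPS_comp X g f z, y) \<in> leq Z \<and> (y, tPS_comp X g f w) \<in> leq Z"
    if "x \<in> pts X" "y \<in> pts Z" "y \<in> (rel Z)\<inverse> `` {tPS_comp X g f x}" for x y
    using f3[of x y] that relX by (metis Image_singleton_iff converse_iff eq)
  ultimately show ?thesis
    using cont mono f1 by (auto simp: tPS_hom_def)
qed

lemma tPS_category_laws:
  assumes "f \<in> tPS_hom X Y" "g \<in> tPS_hom Y Z" "k \<in> tPS_hom Z W"
  shows "tPS_comp X f (tPS_id X) = f" "tPS_comp X (tPS_id Y) f = f"
    and "tPS_comp X k (tPS_comp X g f) = tPS_comp X (tPS_comp Y k g) f"
  using assms
  by (auto simp: tPS_hom_def tPS_comp_def tPS_id_def PiE_iff compose_def restrict_def
      extensional_def fun_eq_iff)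


section \<open>The functors and the natural maps\<close>

definition Psi :: "'x tense_space \<Rightarrow> 'x set tense_lattice" where
  "Psi X = \<lparr> carr = clopen_upsets X, meet = (\<inter>), join = (\<union>), lzero = {}, lone = pts X,
     opG = G_op (pts X) (rel X), opH = H_op (pts X) (rel X),
     opF = F_op (pts X) (rel X), opP = P_op (pts X) (rel X) \<rparr>"

text \<open>\<open>Psi_map X Y f\<close> is the image under \<open>\<Psi>\<close> of a morphism \<open>f\<close> from \<open>X\<close> to \<open>Y\<close>.\<close>

definition Psi_map ::
    "'x tense_space \<Rightarrow> 'y tense_space \<Rightarrow> ('x \<Rightarrow> 'y) \<Rightarrow> 'y set \<Rightarrow> 'x set" where
  "Psi_map X Y f = (\<lambda>U \<in> clopen_upsets Y. {x \<in> pts X. f x \<in> U})"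

definition prime_filter :: "('a, 'm) tense_lattice_scheme \<Rightarrow> 'a set \<Rightarrow> bool" where
  "prime_filter A S \<longleftrightarrow> S \<subseteq> carr A \<and> S \<noteq> {} \<and> S \<noteq> carr A \<and>
     (\<forall>x\<in>S. \<forall>y\<in>carr A. lle A x y \<longrightarrow> y \<in> S) \<and>
     (\<forall>x\<in>S. \<forall>y\<in>S. meet A x y \<in> S) \<and>
     (\<forall>x\<in>carr A. \<forall>y\<in>carr A. join A x y \<in> S \<longrightarrow> x \<in> S \<or> y \<in> S)"

definition prime_filters :: "('a, 'm) tense_lattice_scheme \<Rightarrow> 'a set set" where
  "prime_filters A = {S. prime_filter A S}"

definition sigma_set :: "('a, 'm) tense_lattice_scheme \<Rightarrow> 'a \<Rightarrow> 'a set set" where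
  "sigma_set A a = {T \<in> prime_filters A. a \<in> T}"

definition Phi :: "'a tense_lattice \<Rightarrow> 'a set tense_space" where
  "Phi A = \<lparr>
     topo = topology_generated_by
       (sigma_set A ` carr A \<union> (\<lambda>a. prime_filters A - sigma_set A a) ` carr A),
     leq = {(S, T). S \<in> prime_filters A \<and> T \<in> prime_filters A \<and> S \<subseteq> T},
     rel = {(S, T). S \<in> prime_filters A \<and> T \<in> prime_filters A \<and>
              {a \<in> carr A. opG A a \<in> S} \<subseteq> T \<and> T \<subseteq> {a \<in> carr A. opF A a \<in> S}} \<rparr>"

text \<open>\<open>Phi_map A B h\<close> is the image under \<open>\<Phi>\<close> of a morphism \<open>h\<close> from \<open>A\<close> to \<open>B\<close>.\<close>

definition Phi_map ::
    "'a tense_lattice \<Rightarrow> 'b tense_lattice \<Rightarrow> ('a \<Rightarrow> 'b) \<Rightarrow> 'b set \<Rightarrow> 'a set" where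
  "Phi_map A B h = (\<lambda>S \<in> prime_filters B. {a \<in> carr A. h a \<in> S})"

lemma pts_Phi:
  assumes "tDL A" shows "pts (Phi A) = prime_filters A"
proof -
  interpret tDL A by fact
  have "a \<in> carr A \<Longrightarrow> sigma_set A a \<union> (prime_filters A - sigma_set A a) = prime_filters A" for a
    by (auto simp: sigma_set_def)
  then show ?thesis
    using zero_closed by (auto simp: Phi_def sigma_set_def)
qed

definition sigma_map :: "'a tense_lattice \<Rightarrow> 'a \<Rightarrow> 'a set set" where
  "sigma_map A = (\<lambda>a \<in> carr A. sigma_set A a)"

definition eps :: "'x tense_space \<Rightarrow> 'x \<Rightarrow> 'x set set" where
  "eps X = (\<lambda>x \<in> pts X. {U \<in> clopen_upsets X. x \<in> U})"

end

theory Submission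
  imports Defs
begin

text \<open>
  On top of classical Priestley duality, two facts carry the modal part. Axioms (t4) and (t8), with
  (t1), (t2), (t5), (t6), let the prime filter theorem produce an \<open>R\<^sub>A\<close>-successor of a prime filter \<open>S\<close>
  above any meet-closed set mapped into \<open>S\<close> by \<open>\<^bold>F\<close>, and one avoiding any join-closed set mapped
  outside \<open>S\<close> by \<open>\<^bold>G\<close>; this gives both the preservation of the operators by \<open>\<sigma>\<close> and the back
  conditions for \<open>\<Phi>(h)\<close>. By (t3) and (t7), exchanging past and future operators converts \<open>R\<^sub>A\<close> into its
  converse, so the past half of every argument is an instance of the future half.
\<close>

section \<open>Prime filters\<close>

context bounded_distrib_lattice
begin

lemma meet_idem: "x \<in> carr A \<Longrightarrow> x \<sqinter> x = x"
  using join_absorb[of x x] meet_absorb[of x "x \<sqinter> x"] by (simp add: meet_closed)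

lemma le_refl: "x \<in> carr A \<Longrightarrow> x \<sqsubseteq> x"
  by (simp add: lle_def meet_idem)

lemma le_trans: "\<lbrakk>x \<sqsubseteq> y; y \<sqsubseteq> z; x \<in> carr A; y \<in> carr A; z \<in> carr A\<rbrakk> \<Longrightarrow> x \<sqsubseteq> z"
  using meet_assoc[of x y z] by (simp add: lle_def)

lemma le_antisym: "\<lbrakk>x \<sqsubseteq> y; y \<sqsubseteq> x; x \<in> carr A; y \<in> carr A\<rbrakk> \<Longrightarrow> x = y"
  using meet_comm[of x y] by (simp add: lle_def)

lemma meet_lower2: "\<lbrakk>x \<in> carr A; y \<in> carr A\<rbrakk> \<Longrightarrow> x \<sqinter> y \<sqsubseteq> y"
  by (simp add: lle_def meet_assoc meet_idem)

lemma meet_lower1: "\<lbrakk>x \<in> carr A; y \<in> carr A\<rbrakk> \<Longrightarrow> x \<sqinter> y \<sqsubseteq> x"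
  using meet_lower2[of y x] by (simp add: meet_comm)

lemma meet_greatest:
  "\<lbrakk>z \<sqsubseteq> x; z \<sqsubseteq> y; x \<in> carr A; y \<in> carr A; z \<in> carr A\<rbrakk> \<Longrightarrow> z \<sqsubseteq> x \<sqinter> y"
  using meet_assoc[of z x y] by (simp add: lle_def)

lemma join_upper1: "\<lbrakk>x \<in> carr A; y \<in> carr A\<rbrakk> \<Longrightarrow> x \<sqsubseteq> x \<squnion> y"
  by (simp add: lle_def meet_absorb)

lemma join_upper2: "\<lbrakk>x \<in> carr A; y \<in> carr A\<rbrakk> \<Longrightarrow> y \<sqsubseteq> x \<squnion> y"
  using join_upper1[of y x] by (simp add: join_comm)

lemma le_iff_join:
  assumes "x \<in> carr A" "y \<in> carr A" shows "x \<sqsubseteq> y \<longleftrightarrow> x \<squnion> y = y"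
proof
  assume "x \<sqsubseteq> y"
  then show "x \<squnion> y = y"
    using join_absorb[of y x] assms by (simp add: lle_def meet_comm join_comm)
next
  assume "x \<squnion> y = y"
  then show "x \<sqsubseteq> y" using join_upper1[OF assms] by simp
qed

lemma join_least:
  "\<lbrakk>x \<sqsubseteq> z; y \<sqsubseteq> z; x \<in> carr A; y \<in> carr A; z \<in> carr A\<rbrakk> \<Longrightarrow> x \<squnion> y \<sqsubseteq> z"
  by (simp add: le_iff_join join_closed join_assoc)

lemma meet_mono:
  assumes "x \<sqsubseteq> x'" "y \<sqsubseteq> y'" "x \<in> carr A" "y \<in> carr A" "x' \<in> carr A" "y' \<in> carr A"
  shows "x \<sqinter> y \<sqsubseteq> x' \<sqinter> y'"
  by (rule meet_greatest[OF le_trans[OF meet_lower1 assms(1)] le_trans[OF meet_lower2 assms(2)]])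
    (simp_all add: assms meet_closed)

lemma join_mono:
  assumes "x \<sqsubseteq> x'" "y \<sqsubseteq> y'" "x \<in> carr A" "y \<in> carr A" "x' \<in> carr A" "y' \<in> carr A"
  shows "x \<squnion> y \<sqsubseteq> x' \<squnion> y'"
  by (rule join_least[OF le_trans[OF assms(1) join_upper1] le_trans[OF assms(2) join_upper2]])
    (simp_all add: assms join_closed)

lemma prime_filterD:
  assumes "prime_filter A S"
  shows "S \<subseteq> carr A" "\<zero> \<notin> S" "\<one> \<in> S"
    and "\<lbrakk>x \<in> S; x \<sqsubseteq> y; y \<in> carr A\<rbrakk> \<Longrightarrow> y \<in> S"
    and "\<lbrakk>x \<in> carr A; y \<in> carr A\<rbrakk> \<Longrightarrow> x \<sqinter> y \<in> S \<longleftrightarrow> x \<in> S \<and> y \<in> S"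
    and "\<lbrakk>x \<in> carr A; y \<in> carr A\<rbrakk> \<Longrightarrow> x \<squnion> y \<in> S \<longleftrightarrow> x \<in> S \<or> y \<in> S"
proof -
  show S: "S \<subseteq> carr A" using assms by (auto simp: prime_filter_def)
  show up: "\<lbrakk>x \<in> S; x \<sqsubseteq> y; y \<in> carr A\<rbrakk> \<Longrightarrow> y \<in> S" for x y
    using assms by (auto simp: prime_filter_def)
  show "\<zero> \<notin> S"
    using assms up zero_least unfolding prime_filter_def by blast
  show "\<one> \<in> S"
    using assms up one_greatest one_closed unfolding prime_filter_def by blast
  show "x \<sqinter> y \<in> S \<longleftrightarrow> x \<in> S \<and> y \<in> S" if "x \<in> carr A" "y \<in> carr A"
  proof
    assume "x \<sqinter> y \<in> S"
    with that show "x \<in> S \<and> y \<in> S"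
      by (auto intro: up[OF _ meet_lower1] up[OF _ meet_lower2])
  qed (use assms in \<open>auto simp: prime_filter_def\<close>)
  show "x \<squnion> y \<in> S \<longleftrightarrow> x \<in> S \<or> y \<in> S" if "x \<in> carr A" "y \<in> carr A"
  proof
    assume "x \<in> S \<or> y \<in> S"
    with that show "x \<squnion> y \<in> S"
      by (auto intro: up[OF _ join_upper1] up[OF _ join_upper2] join_closed)
  qed (use that assms in \<open>auto simp: prime_filter_def\<close>)
qed

text \<open>Zorn's lemma on the filters that contain \<open>F\<close> and miss \<open>I\<close>;
  distributivity makes a maximal one prime. \<open>F\<close> and \<open>I\<close> are assumed closed
  under binary meets and joins only, so that later applications can pass bare generating sets;
  \<open>sep\<close> says that the filter generated by \<open>F\<close> misses the ideal generated
  by \<open>I\<close>.\<close>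

theorem prime_filter_exists:
  assumes F: "F \<subseteq> carr A" "F \<noteq> {}" "\<And>x y. \<lbrakk>x \<in> F; y \<in> F\<rbrakk> \<Longrightarrow> x \<sqinter> y \<in> F"
    and I: "I \<subseteq> carr A" "I \<noteq> {}" "\<And>x y. \<lbrakk>x \<in> I; y \<in> I\<rbrakk> \<Longrightarrow> x \<squnion> y \<in> I"
    and sep: "\<And>x y. \<lbrakk>x \<in> F; y \<in> I\<rbrakk> \<Longrightarrow> \<not> x \<sqsubseteq> y"
  shows "\<exists>T. prime_filter A T \<and> F \<subseteq> T \<and> T \<inter> I = {}"
proof -
  define \<F> where "\<F> = {T. T \<subseteq> carr A \<and> (\<forall>x\<in>T. \<forall>y\<in>carr A. x \<sqsubseteq> y \<longrightarrow> y \<in> T) \<and>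
    (\<forall>x\<in>T. \<forall>y\<in>T. x \<sqinter> y \<in> T) \<and> F \<subseteq> T \<and> T \<inter> I = {}}"
  \<comment> \<open>The up-closure serves twice: on \<open>F\<close>, to start the Zorn argument,
    and on the meets of \<open>T\<close> with a new element \<open>x\<close>, where it is the filter
    generated by \<open>T\<close> and \<open>x\<close>.\<close>
  define gen where "gen B = {z \<in> carr A. \<exists>b\<in>B. b \<sqsubseteq> z}" for B
  have gen: "gen B \<in> \<F>"
    if B: "B \<subseteq> carr A" "\<And>x y. \<lbrakk>x \<in> B; y \<in> B\<rbrakk> \<Longrightarrow> x \<sqinter> y \<in> B"
      and FB: "F \<subseteq> gen B" and BI: "\<And>x y. \<lbrakk>x \<in> B; y \<in> I\<rbrakk> \<Longrightarrow> \<not> x \<sqsubseteq> y" for B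
  proof -
    have "y \<in> gen B" if "x \<in> gen B" "y \<in> carr A" "x \<sqsubseteq> y" for x y
      using that B(1) unfolding gen_def by (auto intro: le_trans)
    moreover have "x \<sqinter> y \<in> gen B" if xy: "x \<in> gen B" "y \<in> gen B" for x y
    proof -
      obtain b c where bc: "b \<in> B" "c \<in> B" "b \<sqsubseteq> x" "c \<sqsubseteq> y" and c: "x \<in> carr A" "y \<in> carr A"
        using xy unfolding gen_def by auto
      then have "b \<sqinter> c \<sqsubseteq> x \<sqinter> y"
        using B(1) by (intro meet_mono) auto
      then show ?thesis
        using B(2)[OF bc(1,2)] c meet_closed unfolding gen_def by auto
    qed
    ultimately show ?thesis
      using FB BI unfolding \<F>_def by (auto simp: gen_def)
  qed
  have "F \<subseteq> gen F"
    using F(1) le_refl by (auto simp: gen_def)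
  then have "\<F> \<noteq> {}"
    using gen[OF F(1,3) _ sep] by blast
  moreover have "\<Union>\<C> \<in> \<F>" if "\<C> \<noteq> {}" and ch: "subset.chain \<F> \<C>" for \<C>
  proof -
    have sub: "T \<in> \<F>" if "T \<in> \<C>" for T
      using ch that by (auto simp: subset_chain_def)
    have "x \<sqinter> y \<in> \<Union>\<C>" if xy: "x \<in> \<Union>\<C>" "y \<in> \<Union>\<C>" for x y
    proof -
      obtain T where "T \<in> \<C>" "x \<in> T" "y \<in> T"
        using xy ch unfolding subset_chain_def by blast
      then show ?thesis using sub unfolding \<F>_def by blast
    qed
    moreover have "F \<subseteq> \<Union>\<C>"
      using \<open>\<C> \<noteq> {}\<close> sub unfolding \<F>_def by blast
    moreover have "\<Union>\<C> \<subseteq> carr A" "\<Union>\<C> \<inter> I = {}"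
      using sub unfolding \<F>_def by blast+
    moreover have "\<forall>x\<in>\<Union>\<C>. \<forall>y\<in>carr A. x \<sqsubseteq> y \<longrightarrow> y \<in> \<Union>\<C>"
    proof safe
      fix x y T assume "x \<in> T" "T \<in> \<C>" "y \<in> carr A" "x \<sqsubseteq> y"
      then have "y \<in> T" using sub[OF \<open>T \<in> \<C>\<close>] unfolding \<F>_def by blast
      then show "y \<in> \<Union>\<C>" using \<open>T \<in> \<C>\<close> by blast
    qed
    ultimately show ?thesis unfolding \<F>_def by blast
  qed
  ultimately obtain T where T: "T \<in> \<F>" and max: "\<And>T'. \<lbrakk>T' \<in> \<F>; T \<subseteq> T'\<rbrakk> \<Longrightarrow> T' = T"
    using subset_Zorn_nonempty[of \<F>] by metis
  have Tc: "T \<subseteq> carr A" and up: "\<And>x y. \<lbrakk>x \<in> T; x \<sqsubseteq> y; y \<in> carr A\<rbrakk> \<Longrightarrow> y \<in> T"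
    and mt: "\<And>x y. \<lbrakk>x \<in> T; y \<in> T\<rbrakk> \<Longrightarrow> x \<sqinter> y \<in> T" and FT: "F \<subseteq> T" and TI: "T \<inter> I = {}"
    using T unfolding \<F>_def by auto
  \<comment> \<open>Maximality in usable form: the filter generated by \<open>T\<close> and an
    outside element \<open>x\<close> must meet the ideal generated by \<open>I\<close>.\<close>
  have ext: "\<exists>t\<in>T. \<exists>i\<in>I. t \<sqinter> x \<sqsubseteq> i" if x: "x \<in> carr A" "x \<notin> T" for x
  proof (rule ccontr)
    assume no: "\<not> ?thesis"
    let ?B = "(\<lambda>t. t \<sqinter> x) ` T"
    have cl: "u \<sqinter> v \<in> ?B" if uv: "u \<in> ?B" "v \<in> ?B" for u v
    proof -
      obtain s t where st: "s \<in> T" "t \<in> T" "u = s \<sqinter> x" "v = t \<sqinter> x"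
        using uv by blast
      then have c: "s \<in> carr A" "t \<in> carr A" using Tc by auto
      have "u \<sqinter> v = s \<sqinter> (x \<sqinter> (t \<sqinter> x))"
        using st c x by (simp add: meet_assoc meet_closed)
      also have "x \<sqinter> (t \<sqinter> x) = t \<sqinter> x"
        using c x by (metis meet_lower2 lle_def meet_closed meet_comm)
      also have "s \<sqinter> (t \<sqinter> x) = (s \<sqinter> t) \<sqinter> x"
        using c x by (simp add: meet_assoc)
      finally show ?thesis using mt[OF st(1,2)] by blast
    qed
    have sub: "T \<subseteq> gen ?B"
      using Tc x(1) meet_lower1 unfolding gen_def by blast
    have "gen ?B \<in> \<F>"
      using no Tc x(1) cl sub FT meet_closed by (intro gen) blast+
    then have "gen ?B = T" using max sub by blast
    moreover have "x \<in> gen ?B"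
      using FT F(2) Tc x(1) meet_lower2 unfolding gen_def by blast
    ultimately show False using x(2) by blast
  qed
  have "x \<in> T \<or> y \<in> T" if xy: "x \<in> carr A" "y \<in> carr A" "x \<squnion> y \<in> T" for x y
  proof (rule ccontr)
    assume "\<not> ?thesis"
    then obtain s i t j where *: "s \<in> T" "i \<in> I" "s \<sqinter> x \<sqsubseteq> i" "t \<in> T" "j \<in> I" "t \<sqinter> y \<sqsubseteq> j"
      using ext xy by metis
    have c: "s \<in> carr A" "t \<in> carr A" "i \<in> carr A" "j \<in> carr A" using * Tc I(1) by auto
    \<comment> \<open>\<open>s \<sqinter> t\<close> is a common witness for \<open>x\<close> and
      \<open>y\<close>, so that distributivity can merge the two inequalities into one about
      \<open>x \<squnion> y\<close>.\<close>
    have "(s \<sqinter> t) \<sqinter> x \<sqsubseteq> s \<sqinter> x" "(s \<sqinter> t) \<sqinter> y \<sqsubseteq> t \<sqinter> y"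
      using c xy by (auto intro!: meet_mono meet_lower1 meet_lower2 le_refl meet_closed)
    then have "(s \<sqinter> t) \<sqinter> x \<sqsubseteq> i" "(s \<sqinter> t) \<sqinter> y \<sqsubseteq> j"
      using * c xy by (meson le_trans meet_closed)+
    then have "(s \<sqinter> t) \<sqinter> x \<squnion> (s \<sqinter> t) \<sqinter> y \<sqsubseteq> i \<squnion> j"
      using c xy by (intro join_mono) (auto intro: meet_closed)
    then have "(s \<sqinter> t) \<sqinter> (x \<squnion> y) \<sqsubseteq> i \<squnion> j"
      using c xy by (simp add: meet_join_distrib meet_closed)
    then have "i \<squnion> j \<in> T"
      using mt[OF mt[OF *(1,4)] xy(3)] c by (blast intro: up join_closed)
    then show False using I(3)[OF *(2,5)] TI by blast
  qed
  moreover have "T \<noteq> {}" "T \<noteq> carr A"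
    using FT F(2) TI I(1,2) by auto
  ultimately have "prime_filter A T"
    using Tc up mt unfolding prime_filter_def by blast
  then show ?thesis using FT TI by blast
qed

text \<open>The case of singletons, from which the injectivity of \<open>\<sigma>\<close>
  follows.\<close>

lemma prime_filter_separates:
  assumes "a \<in> carr A" "b \<in> carr A" "\<not> a \<sqsubseteq> b"
  shows "\<exists>T. prime_filter A T \<and> a \<in> T \<and> b \<notin> T"
proof -
  have "b \<squnion> b = b"
    using assms(2) le_iff_join le_refl by blast
  then show ?thesis
    using prime_filter_exists[of "{a}" "{b}"] assms meet_idem[of a] by auto
qed

end

section \<open>The canonical relation\<close>

text \<open>The condition defining \<open>R\<^sub>A\<close>, stated for arbitrary sets rather than
  prime filters. Only the future operators occur in it; the past ones enter through
  \<open>canon_rel_rev\<close>.\<close>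

definition canon_rel :: "('a, 'm) tense_lattice_scheme \<Rightarrow> 'a set \<Rightarrow> 'a set \<Rightarrow> bool" where
  "canon_rel A S T \<longleftrightarrow> {a \<in> carr A. opG A a \<in> S} \<subseteq> T \<and> T \<subseteq> {a \<in> carr A. opF A a \<in> S}"

context tDL
begin

lemma G_mono: "\<lbrakk>x \<sqsubseteq> y; x \<in> carr A; y \<in> carr A\<rbrakk> \<Longrightarrow> opG A x \<sqsubseteq> opG A y"
  using t2(1)[of x y] by (simp add: lle_def)

lemma F_mono: "\<lbrakk>x \<sqsubseteq> y; x \<in> carr A; y \<in> carr A\<rbrakk> \<Longrightarrow> opF A x \<sqsubseteq> opF A y"
  using t6(1)[of x y] by (simp add: le_iff_join F_closed)

text \<open>\<open>T\<close> must contain \<open>K\<close> and every \<open>g\<close> with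
  \<open>opG A g \<in> S\<close>, and miss every \<open>b\<close> with
  \<open>opF A b \<notin> S\<close>. These demands are compatible: if
  \<open>g \<sqinter> k \<sqsubseteq> b\<close>, then (t8) and monotonicity carry
  \<open>opG A g \<sqinter> opF A k\<close>, a member of \<open>S\<close>, below
  \<open>opF A b\<close>.\<close>

lemma canon_rel_above:
  assumes S: "prime_filter A S"
    and K: "K \<subseteq> carr A" "K \<noteq> {}" "\<And>x y. \<lbrakk>x \<in> K; y \<in> K\<rbrakk> \<Longrightarrow> x \<sqinter> y \<in> K"
    and FK: "\<And>x. x \<in> K \<Longrightarrow> opF A x \<in> S"
  shows "\<exists>T. prime_filter A T \<and> canon_rel A S T \<and> K \<subseteq> T"
proof -
  note pf = prime_filterD[OF S]
  let ?g = "{a \<in> carr A. opG A a \<in> S}"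
  let ?B = "{g \<sqinter> k | g k. g \<in> ?g \<and> k \<in> K}" and ?I = "{b \<in> carr A. opF A b \<notin> S}"
  have one: "\<one> \<in> ?g" using one_closed t1(1) pf(3) by simp
  have kc: "k \<in> K \<Longrightarrow> k \<in> carr A" for k using K(1) by auto
  have g: "g \<in> ?g \<Longrightarrow> g' \<in> ?g \<Longrightarrow> g \<sqinter> g' \<in> ?g" for g g'
    using pf(5) by (simp add: t2(1) meet_closed G_closed)
  have "\<exists>T. prime_filter A T \<and> ?B \<subseteq> T \<and> T \<inter> ?I = {}"
  proof (rule prime_filter_exists)
    show "?B \<subseteq> carr A" using kc meet_closed by auto
    show "?B \<noteq> {}" using one K(2) by blast
    show "x \<sqinter> y \<in> ?B" if xy: "x \<in> ?B" "y \<in> ?B" for x y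
    proof -
      obtain g k g' k' where *: "g \<in> ?g" "k \<in> K" "g' \<in> ?g" "k' \<in> K" "x = g \<sqinter> k" "y = g' \<sqinter> k'"
        using xy by blast
      then have c: "g \<in> carr A" "k \<in> carr A" "g' \<in> carr A" "k' \<in> carr A" using kc by auto
      have "x \<sqinter> y = g \<sqinter> ((k \<sqinter> g') \<sqinter> k')"
        using * c by (simp add: meet_assoc meet_closed)
      also have "\<dots> = g \<sqinter> ((g' \<sqinter> k) \<sqinter> k')"
        using c by (simp add: meet_comm)
      also have "\<dots> = (g \<sqinter> g') \<sqinter> (k \<sqinter> k')"
        using c by (simp add: meet_assoc meet_closed)
      finally show ?thesis
        using g[OF *(1,3)] K(3)[OF *(2,4)] by blast
    qed
    show "?I \<subseteq> carr A" by auto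
    show "?I \<noteq> {}" using zero_closed t5(1) pf(2) by auto
    show "x \<squnion> y \<in> ?I" if "x \<in> ?I" "y \<in> ?I" for x y
      using that by (simp add: t6(1) join_closed F_closed pf(6))
    show "\<not> x \<sqsubseteq> y" if x: "x \<in> ?B" and y: "y \<in> ?I" for x y
    proof
      assume le: "x \<sqsubseteq> y"
      obtain g k where *: "g \<in> ?g" "k \<in> K" "x = g \<sqinter> k" using x by blast
      then have c: "g \<in> carr A" "k \<in> carr A" "x \<in> carr A" using kc meet_closed by auto
      have "opG A g \<sqinter> opF A k \<in> S"
        using * c FK by (simp add: pf(5) G_closed F_closed)
      then have "opF A x \<in> S"
        using * c t8(1)[of g k] by (blast intro: pf(4) F_closed)
      then show False
        using y c F_mono[OF le] by (blast intro: pf(4) F_closed)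
    qed
  qed
  then obtain T where T: "prime_filter A T" "?B \<subseteq> T" "T \<inter> ?I = {}" by blast
  note pfT = prime_filterD[OF T(1)]
  \<comment> \<open>\<open>T\<close> was built to contain the meets \<open>g \<sqinter> k\<close>;
    each factor is recovered by pairing it with \<open>\<one>\<close> or with some member of
    \<open>K\<close>.\<close>
  have split: "g \<in> T \<and> k \<in> T" if "g \<in> ?g" "k \<in> K" for g k
    using that T(2) pfT(5)[of g k] kc by blast
  then have "?g \<subseteq> T" "K \<subseteq> T" using one K(2) by blast+
  moreover have "T \<subseteq> {a \<in> carr A. opF A a \<in> S}" using T(3) pfT(1) by blast
  ultimately show ?thesis using T(1) unfolding canon_rel_def by blast
qed

text \<open>Order dual of the preceding construction: if
  \<open>g \<sqsubseteq> k \<squnion> b\<close>, then (t4) puts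
  \<open>opG A k \<squnion> opF A b\<close> into \<open>S\<close>, while neither joinand belongs to
  the prime filter \<open>S\<close>.\<close>

lemma canon_rel_avoiding:
  assumes S: "prime_filter A S"
    and K: "K \<subseteq> carr A" "K \<noteq> {}" "\<And>x y. \<lbrakk>x \<in> K; y \<in> K\<rbrakk> \<Longrightarrow> x \<squnion> y \<in> K"
    and GK: "\<And>x. x \<in> K \<Longrightarrow> opG A x \<notin> S"
  shows "\<exists>T. prime_filter A T \<and> canon_rel A S T \<and> T \<inter> K = {}"
proof -
  note pf = prime_filterD[OF S]
  let ?B = "{a \<in> carr A. opG A a \<in> S}"
  let ?f = "{b \<in> carr A. opF A b \<notin> S}"
  let ?I = "{k \<squnion> b | k b. k \<in> K \<and> b \<in> ?f}"
  have zero: "\<zero> \<in> ?f" using zero_closed t5(1) pf(2) by simp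
  have kc: "k \<in> K \<Longrightarrow> k \<in> carr A" for k using K(1) by auto
  have f: "b \<in> ?f \<Longrightarrow> b' \<in> ?f \<Longrightarrow> b \<squnion> b' \<in> ?f" for b b'
    using pf(6) by (simp add: t6(1) join_closed F_closed)
  have "\<exists>T. prime_filter A T \<and> ?B \<subseteq> T \<and> T \<inter> ?I = {}"
  proof (rule prime_filter_exists)
    show "?I \<subseteq> carr A" using kc join_closed by auto
    show "?I \<noteq> {}" using zero K(2) by blast
    show "x \<squnion> y \<in> ?I" if xy: "x \<in> ?I" "y \<in> ?I" for x y
    proof -
      obtain k b k' b' where *: "k \<in> K" "b \<in> ?f" "k' \<in> K" "b' \<in> ?f" "x = k \<squnion> b" "y = k' \<squnion> b'"
        using xy by blast
      then have c: "k \<in> carr A" "b \<in> carr A" "k' \<in> carr A" "b' \<in> carr A" using kc by auto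
      have "x \<squnion> y = k \<squnion> ((b \<squnion> k') \<squnion> b')"
        using * c by (simp add: join_assoc join_closed)
      also have "\<dots> = k \<squnion> ((k' \<squnion> b) \<squnion> b')"
        using c by (simp add: join_comm)
      also have "\<dots> = (k \<squnion> k') \<squnion> (b \<squnion> b')"
        using c by (simp add: join_assoc join_closed)
      finally show ?thesis
        using f[OF *(2,4)] K(3)[OF *(1,3)] by blast
    qed
    show "?B \<subseteq> carr A" by auto
    show "?B \<noteq> {}" using one_closed t1(1) pf(3) by auto
    show "x \<sqinter> y \<in> ?B" if "x \<in> ?B" "y \<in> ?B" for x y
      using that by (simp add: t2(1) meet_closed G_closed pf(5))
    show "\<not> x \<sqsubseteq> y" if x: "x \<in> ?B" and y: "y \<in> ?I" for x y
    proof
      assume le: "x \<sqsubseteq> y"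
      obtain k b where *: "k \<in> K" "b \<in> ?f" "y = k \<squnion> b" using y by blast
      then have c: "k \<in> carr A" "b \<in> carr A" "y \<in> carr A" using kc join_closed by auto
      have "opG A y \<in> S"
        using x c G_mono[OF le] by (blast intro: pf(4) G_closed)
      then have "opG A k \<squnion> opF A b \<in> S"
        using * c t4(1)[of k b] by (blast intro: pf(4) G_closed F_closed join_closed)
      then show False
        using * c GK pf(6)[of "opG A k" "opF A b"] G_closed F_closed by blast
    qed
  qed
  then obtain T where T: "prime_filter A T" "?B \<subseteq> T" "T \<inter> ?I = {}" by blast
  note pfT = prime_filterD[OF T(1)]
  have split: "k \<notin> T \<and> b \<notin> T" if "k \<in> K" "b \<in> ?f" for k b
    using that T(3) pfT(6)[of k b] kc by blast
  then have "T \<inter> K = {}" "T \<inter> ?f = {}" using zero K(2) by blast+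
  moreover from this have "T \<subseteq> {a \<in> carr A. opF A a \<in> S}" using pfT(1) by blast
  ultimately show ?thesis using T(1,2) unfolding canon_rel_def by blast
qed

lemma F_iff_canon_rel:
  assumes S: "prime_filter A S" and a: "a \<in> carr A"
  shows "opF A a \<in> S \<longleftrightarrow> (\<exists>T. prime_filter A T \<and> canon_rel A S T \<and> a \<in> T)"
proof
  assume "opF A a \<in> S"
  then show "\<exists>T. prime_filter A T \<and> canon_rel A S T \<and> a \<in> T"
    using canon_rel_above[OF S, of "{a}"] a meet_idem[OF a] by auto
qed (auto simp: canon_rel_def)

lemma G_iff_canon_rel:
  assumes S: "prime_filter A S" and a: "a \<in> carr A"
  shows "opG A a \<in> S \<longleftrightarrow> (\<forall>T. prime_filter A T \<and> canon_rel A S T \<longrightarrow> a \<in> T)"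
proof
  assume *: "\<forall>T. prime_filter A T \<and> canon_rel A S T \<longrightarrow> a \<in> T"
  have "a \<squnion> a = a" using a le_iff_join le_refl by blast
  then show "opG A a \<in> S"
    using canon_rel_avoiding[OF S, of "{a}"] a * by blast
qed (use a in \<open>auto simp: canon_rel_def\<close>)

end

text \<open>Time reversal reduces every statement about the past operators to its future counterpart.\<close>

definition lattice_rev :: "('a, 'm) tense_lattice_scheme \<Rightarrow> ('a, 'm) tense_lattice_scheme" where
  "lattice_rev A = A\<lparr>opG := opH A, opH := opG A, opF := opP A, opP := opF A\<rparr>"

lemma lattice_rev_simps [simp]:
  "carr (lattice_rev A) = carr A" "meet (lattice_rev A) = meet A" "join (lattice_rev A) = join A"
  "lzero (lattice_rev A) = lzero A" "lone (lattice_rev A) = lone A"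
  "opG (lattice_rev A) = opH A" "opH (lattice_rev A) = opG A"
  "opF (lattice_rev A) = opP A" "opP (lattice_rev A) = opF A"
  "lle (lattice_rev A) = lle A" "prime_filter (lattice_rev A) = prime_filter A"
  by (simp_all add: lattice_rev_def lle_def prime_filter_def fun_eq_iff)

context tDL
begin

text \<open>Each of (t1) to (t8) is a pair of statements that the exchange of past and future
  swaps.\<close>

lemma tDL_lattice_rev: "tDL (lattice_rev A)"
proof -
  interpret R: bounded_distrib_lattice "lattice_rev A"
    using bounded_distrib_lattice_axioms
    unfolding bounded_distrib_lattice_def lattice_rev_simps .
  show ?thesis
    by unfold_locales (simp_all add: G_closed H_closed F_closed P_closed t1 t2 t3 t4 t5 t6 t7 t8)
qed

text \<open>(t3) and (t7) are the units and counits of the adjunctions of \<open>opP\<close> with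
  \<open>opG\<close> and of \<open>opF\<close> with \<open>opH\<close>. The first makes the
  inclusion for \<open>opG\<close> equivalent to the one for \<open>opP\<close>, the second does the
  same for \<open>opF\<close> and \<open>opH\<close>.\<close>

lemma canon_rel_rev:
  assumes S: "prime_filter A S" and T: "prime_filter A T"
  shows "canon_rel (lattice_rev A) T S \<longleftrightarrow> canon_rel A S T"
proof
  note pS = prime_filterD[OF S] and pT = prime_filterD[OF T]
  show "canon_rel A S T" if R: "canon_rel (lattice_rev A) T S"
    unfolding canon_rel_def
  proof safe
    fix a assume a: "a \<in> carr A" "opG A a \<in> S"
    then have "opP A (opG A a) \<in> T" using R by (auto simp: canon_rel_def)
    then show "a \<in> T" using a t7(1) pT(4) by blast
  next
    fix a assume a: "a \<in> T"
    then have c: "a \<in> carr A" using pT(1) by blast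
    have "opH A (opF A a) \<in> T" using a c t3(2) pT(4) H_closed F_closed by blast
    then show "opF A a \<in> S" using R c F_closed by (auto simp: canon_rel_def)
  qed (use pT(1) in auto)
  show "canon_rel (lattice_rev A) T S" if R: "canon_rel A S T"
    unfolding canon_rel_def lattice_rev_simps
  proof safe
    fix a assume a: "a \<in> carr A" "opH A a \<in> T"
    then have "opF A (opH A a) \<in> S" using R by (auto simp: canon_rel_def)
    then show "a \<in> S" using a t7(2) pS(4) by blast
  next
    fix a assume a: "a \<in> S"
    then have c: "a \<in> carr A" using pS(1) by blast
    have "opG A (opP A a) \<in> S" using a c t3(1) pS(4) G_closed P_closed by blast
    then show "opP A a \<in> T" using R c P_closed by (auto simp: canon_rel_def)
  qed (use pS(1) in auto)
qed

lemma P_iff_canon_rel: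
  assumes S: "prime_filter A S" and a: "a \<in> carr A"
  shows "opP A a \<in> S \<longleftrightarrow> (\<exists>T. prime_filter A T \<and> canon_rel A T S \<and> a \<in> T)"
  using tDL.F_iff_canon_rel[OF tDL_lattice_rev, of S a] assms canon_rel_rev by auto

lemma H_iff_canon_rel:
  assumes S: "prime_filter A S" and a: "a \<in> carr A"
  shows "opH A a \<in> S \<longleftrightarrow> (\<forall>T. prime_filter A T \<and> canon_rel A T S \<longrightarrow> a \<in> T)"
  using tDL.G_iff_canon_rel[OF tDL_lattice_rev, of S a] assms canon_rel_rev by auto

end

section \<open>The dual space of an algebra\<close>

text \<open>A finite subcover collapses to its union, which is again a member of
  \<open>\<D>\<close>; \<open>{} \<in> \<D>\<close> takes care of the empty subcover. The covering
  arguments below all use compactness in this form or in the complementary one.\<close>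

lemma closed_subset_directed_open:
  assumes "compact_space T" "closedin T K"
    and D: "\<And>U. U \<in> \<D> \<Longrightarrow> openin T U" "{} \<in> \<D>" "\<And>U V. \<lbrakk>U \<in> \<D>; V \<in> \<D>\<rbrakk> \<Longrightarrow> U \<union> V \<in> \<D>"
    and cover: "\<And>z. z \<in> K \<Longrightarrow> \<exists>U\<in>\<D>. z \<in> U"
  shows "\<exists>U\<in>\<D>. K \<subseteq> U"
proof -
  have "compactin T K" using assms(1,2) by (rule closedin_compact_space)
  then obtain \<F> where F: "finite \<F>" "\<F> \<subseteq> \<D>" "K \<subseteq> \<Union>\<F>"
    using cover D(1) unfolding compactin_def by (meson Union_iff subsetI)
  from F(1,2) have "\<Union>\<F> \<in> \<D>"
    by (induction \<F>) (auto simp: D(2,3))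
  then show ?thesis using F(3) by blast
qed

lemma closed_disjoint_directed_closed:
  assumes "compact_space T" "closedin T K"
    and D: "\<And>U. U \<in> \<D> \<Longrightarrow> closedin T U" "topspace T \<in> \<D>"
      "\<And>U V. \<lbrakk>U \<in> \<D>; V \<in> \<D>\<rbrakk> \<Longrightarrow> U \<inter> V \<in> \<D>"
    and avoid: "\<And>z. z \<in> K \<Longrightarrow> \<exists>U\<in>\<D>. z \<notin> U"
  shows "\<exists>U\<in>\<D>. U \<inter> K = {}"
proof -
  have Kt: "K \<subseteq> topspace T" using assms(2) closedin_subset by blast
  have "\<exists>U\<in>(-) (topspace T) ` \<D>. K \<subseteq> U"
  proof (rule closed_subset_directed_open[OF assms(1,2)])
    show "{} \<in> (-) (topspace T) ` \<D>" using D(2) by force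
    show "U \<union> V \<in> (-) (topspace T) ` \<D>"
      if "U \<in> (-) (topspace T) ` \<D>" "V \<in> (-) (topspace T) ` \<D>" for U V
      using that D(3) by (auto simp: Diff_Int[symmetric])
    show "\<exists>U\<in>(-) (topspace T) ` \<D>. z \<in> U" if z: "z \<in> K" for z
    proof -
      obtain U where "U \<in> \<D>" "z \<notin> U" using avoid[OF z] by blast
      then show ?thesis using z Kt by (intro bexI[of _ "topspace T - U"]) auto
    qed
  qed (use D(1) in auto)
  then show ?thesis by blast
qed

section \<open>Priestley spaces and their clopen up-sets\<close>

context priestley_space
begin

lemma leq_on: "(x, y) \<in> leq X \<Longrightarrow> x \<in> pts X \<and> y \<in> pts X"
  using partial_order by (auto simp: order_on_defs)

lemma leq_refl: "x \<in> pts X \<Longrightarrow> (x, x) \<in> leq X"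
  using partial_order by (auto simp: order_on_defs refl_on_def)

lemma leq_antisym: "\<lbrakk>(x, y) \<in> leq X; (y, x) \<in> leq X\<rbrakk> \<Longrightarrow> x = y"
  using partial_order by (auto simp: order_on_defs antisym_def)

lemma clopen_upset_leq: "\<lbrakk>U \<in> clopen_upsets X; x \<in> U; (x, y) \<in> leq X\<rbrakk> \<Longrightarrow> y \<in> U"
  by (auto simp: clopen_upsets_def upset_def)

lemma clopen_upset_subset: "U \<in> clopen_upsets X \<Longrightarrow> U \<subseteq> pts X"
  by (auto simp: clopen_upsets_def upset_def)

lemma clopen_upsets_lattice:
  "{} \<in> clopen_upsets X" "pts X \<in> clopen_upsets X"
  "\<lbrakk>U \<in> clopen_upsets X; V \<in> clopen_upsets X\<rbrakk> \<Longrightarrow> U \<union> V \<in> clopen_upsets X"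
  "\<lbrakk>U \<in> clopen_upsets X; V \<in> clopen_upsets X\<rbrakk> \<Longrightarrow> U \<inter> V \<in> clopen_upsets X"
     apply (auto simp: clopen_upsets_def upset_def)[1]
    apply (use leq_on in \<open>auto simp: clopen_upsets_def upset_def\<close>)[1]
   apply (auto simp: clopen_upsets_def upset_def)[2]
  done

text \<open>By antisymmetry one of two distinct points is not below the other, and a separating
  clopen up-set and its complement are both open. This is what later turns continuous bijections
  into homeomorphisms.\<close>

lemma Hausdorff: "Hausdorff_space (topo X)"
  unfolding Hausdorff_space_def
proof (intro allI impI)
  fix x y assume xy: "x \<in> pts X \<and> y \<in> pts X \<and> x \<noteq> y"
  then have "(x, y) \<notin> leq X \<or> (y, x) \<notin> leq X" using leq_antisym by blast
  then obtain U where "U \<in> clopen_upsets X" "x \<in> U \<and> y \<notin> U \<or> y \<in> U \<and> x \<notin> U"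
    using separation xy by metis
  moreover from this have "openin (topo X) U" "openin (topo X) (pts X - U)"
    by (auto simp: clopen_upsets_def)
  ultimately show "\<exists>U V. openin (topo X) U \<and> openin (topo X) V \<and> x \<in> U \<and> y \<in> V \<and> disjnt U V"
    using xy by (metis DiffI disjnt_def Diff_disjoint inf_commute)
qed

text \<open>A clopen up-set \<open>W\<close> is assembled from members of \<open>\<D>\<close> by two
  compactness arguments, one on the complement of \<open>W\<close> and one on \<open>W\<close>.
  Applied to the sets \<open>sigma_set A a\<close>, this gives the surjectivity of
  \<open>\<sigma>\<close>.\<close>

lemma separating_sublattice_eq_clopen_upsets:
  assumes D: "\<D> \<subseteq> clopen_upsets X" "{} \<in> \<D>" "pts X \<in> \<D>"
      "\<And>U V. \<lbrakk>U \<in> \<D>; V \<in> \<D>\<rbrakk> \<Longrightarrow> U \<union> V \<in> \<D>" "\<And>U V. \<lbrakk>U \<in> \<D>; V \<in> \<D>\<rbrakk> \<Longrightarrow> U \<inter> V \<in> \<D>"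
    and sep: "\<And>x y. \<lbrakk>x \<in> pts X; y \<in> pts X; (x, y) \<notin> leq X\<rbrakk> \<Longrightarrow> \<exists>U\<in>\<D>. x \<in> U \<and> y \<notin> U"
  shows "\<D> = clopen_upsets X"
proof
  show "clopen_upsets X \<subseteq> \<D>"
  proof
    fix W assume W: "W \<in> clopen_upsets X"
    have opn: "openin (topo X) U" and cls: "closedin (topo X) U" if "U \<in> \<D>" for U
      using that D(1) by (auto simp: clopen_upsets_def)
    have WX: "W \<subseteq> pts X" and Wc: "closedin (topo X) W" and Wd: "closedin (topo X) (pts X - W)"
      using W by (auto simp: clopen_upsets_def upset_def)
    \<comment> \<open>No point outside the up-set \<open>W\<close> lies above \<open>x\<close>, so
      each is excluded by some member of \<open>\<D>\<close> containing \<open>x\<close>; finitely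
      many of these, intersected, exclude the whole complement.\<close>
    have small: "\<exists>U\<in>\<D>. x \<in> U \<and> U \<subseteq> W" if x: "x \<in> W" for x
    proof -
      have "\<exists>U\<in>{U\<in>\<D>. x \<in> U}. U \<inter> (pts X - W) = {}"
      proof (rule closed_disjoint_directed_closed[OF compact Wd])
        show "\<exists>U\<in>{U\<in>\<D>. x \<in> U}. z \<notin> U" if z: "z \<in> pts X - W" for z
          using sep[of x z] clopen_upset_leq[OF W x] x z WX by blast
      qed (use D x WX cls in auto)
      then show ?thesis using D(1) clopen_upset_subset by blast
    qed
    \<comment> \<open>The members of \<open>\<D>\<close> inside \<open>W\<close> are closed under
      union and cover \<open>W\<close>; one of them therefore equals \<open>W\<close>.\<close>
    have "\<exists>U\<in>{U\<in>\<D>. U \<subseteq> W}. W \<subseteq> U"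
    proof (rule closed_subset_directed_open[OF compact Wc])
      show "\<exists>U\<in>{U\<in>\<D>. U \<subseteq> W}. z \<in> U" if "z \<in> W" for z
        using small[OF that] by blast
    qed (use D opn in auto)
    then show "W \<in> \<D>" by auto
  qed
qed fact

end

section \<open>The prime filter space\<close>

text \<open>Bridge between two descriptions of one topology: \<open>Phi\<close> is defined by the
  left-hand one, \<open>Alexander_subbase\<close> speaks of the right-hand one.\<close>

lemma topology_generated_by_subbase:
  "topology_generated_by \<B> =
     topology (arbitrary union_of (finite intersection_of (\<lambda>x. x \<in> \<B>) relative_to \<Union>\<B>))"
  (is "_ = ?T")
proof -
  have op: "openin ?T U" if "U \<in> \<B>" for U
    unfolding openin_subbase
    by (rule union_of_inc)
      (use that in \<open>auto simp: relative_to_def arbitrary_def intro!: exI[of _ U] finite_intersection_of_inc\<close>)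
  have "openin ?T U" if "generate_topology_on \<B> U" for U
    using that
  proof induction
    case (UN K) then show ?case by blast
  qed (auto intro: op)
  moreover have "openin (topology_generated_by \<B>) U" if "openin ?T U" for U
    by (rule minimal_topology_subbase[OF topology_generated_by_Basis _ that])
      (use openin_topspace[of "topology_generated_by \<B>"] in simp_all)
  ultimately show ?thesis
    by (metis topology_eq openin_topology_generated_by_iff)
qed

lemma sigma_set_iff: "T \<in> sigma_set A a \<longleftrightarrow> prime_filter A T \<and> a \<in> T"
  by (simp add: sigma_set_def prime_filters_def)

lemma sigma_set_eq: "sigma_set A a = {T. prime_filter A T \<and> a \<in> T}"
  by (auto simp: sigma_set_iff)

lemma Phi_leq_iff: "(S, T) \<in> leq (Phi A) \<longleftrightarrow> prime_filter A S \<and> prime_filter A T \<and> S \<subseteq> T"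
  by (auto simp: Phi_def prime_filters_def)

lemma Phi_rel_iff: "(S, T) \<in> rel (Phi A) \<longleftrightarrow> prime_filter A S \<and> prime_filter A T \<and> canon_rel A S T"
  by (auto simp: Phi_def prime_filters_def canon_rel_def)

text \<open>Alexander's subbase theorem reduces the claim to a cover \<open>C\<close> by sets
  \<open>sigma_set A a\<close> and their complements. If no finite part of \<open>C\<close> covers,
  the filter generated by the elements of \<open>F\<^sub>0\<close> misses the ideal generated by
  those of \<open>I\<^sub>0\<close>, and a prime filter between them is a point that
  \<open>C\<close> leaves uncovered.\<close>

lemma Phi_compact:
  assumes "tDL A" shows "compact_space (topo (Phi A))"
proof -
  interpret tDL A by fact
  let ?X = "prime_filters A"
  let ?B = "sigma_set A ` carr A \<union> (\<lambda>a. ?X - sigma_set A a) ` carr A"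
  have B: "\<Union>?B = ?X"
    using pts_Phi[OF assms] by (simp add: Phi_def)
  show ?thesis
  proof (rule Alexander_subbase)
    show "topology (arbitrary union_of (finite intersection_of (\<lambda>x. x \<in> ?B) relative_to \<Union>?B)) = topo (Phi A)"
      unfolding topology_generated_by_subbase[of ?B, symmetric] by (simp add: Phi_def)
    fix C assume C: "C \<subseteq> ?B" "\<Union>C = topspace (topo (Phi A))"
    show "\<exists>C'. finite C' \<and> C' \<subseteq> C \<and> \<Union>C' = topspace (topo (Phi A))"
    proof (rule ccontr)
      assume no: "\<not> ?thesis"
      define I\<^sub>0 where "I\<^sub>0 = {a \<in> carr A. sigma_set A a \<in> C}"
      define F\<^sub>0 where "F\<^sub>0 = {a \<in> carr A. ?X - sigma_set A a \<in> C}"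
      \<comment> \<open>The generated filter and ideal are described by points: finitely many
        generators in a prime filter force \<open>x\<close> into it, or \<open>x\<close> in a prime
        filter forces one of finitely many generators into it. Closure under meet and join then
        amounts to uniting the finite sets, with no iterated lattice operations.\<close>
      define F where "F = {x \<in> carr A. \<exists>D\<subseteq>F\<^sub>0. finite D \<and> {T \<in> ?X. D \<subseteq> T} \<subseteq> sigma_set A x}"
      define I where "I = {x \<in> carr A. \<exists>E\<subseteq>I\<^sub>0. finite E \<and> sigma_set A x \<subseteq> {T. T \<inter> E \<noteq> {}}}"
      have "\<exists>T. prime_filter A T \<and> F \<subseteq> T \<and> T \<inter> I = {}"
      proof (rule prime_filter_exists)
        show "F \<subseteq> carr A" "I \<subseteq> carr A" by (auto simp: F_def I_def)
        have "\<one>\<^bsub>A\<^esub> \<in> F"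
          unfolding F_def using prime_filterD(3) one_closed
          by (intro CollectI conjI exI[of _ "{}"]) (auto simp: sigma_set_iff prime_filters_def)
        then show "F \<noteq> {}" by blast
        have "\<zero>\<^bsub>A\<^esub> \<in> I"
          unfolding I_def using prime_filterD(2) zero_closed
          by (intro CollectI conjI exI[of _ "{}"]) (auto simp: sigma_set_iff)
        then show "I \<noteq> {}" by blast
        show "x \<sqinter>\<^bsub>A\<^esub> y \<in> F" if xy: "x \<in> F" "y \<in> F" for x y
        proof -
          obtain D E where DE: "D \<subseteq> F\<^sub>0" "finite D" "{T \<in> ?X. D \<subseteq> T} \<subseteq> sigma_set A x"
            "E \<subseteq> F\<^sub>0" "finite E" "{T \<in> ?X. E \<subseteq> T} \<subseteq> sigma_set A y"
            and c: "x \<in> carr A" "y \<in> carr A"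
            using xy unfolding F_def by auto
          have "{T \<in> ?X. D \<union> E \<subseteq> T} \<subseteq> sigma_set A (x \<sqinter>\<^bsub>A\<^esub> y)"
            using DE(3,6) c by (auto simp: sigma_set_eq prime_filters_def prime_filterD(5))
          then have "\<exists>D\<subseteq>F\<^sub>0. finite D \<and> {T \<in> ?X. D \<subseteq> T} \<subseteq> sigma_set A (x \<sqinter>\<^bsub>A\<^esub> y)"
            using DE by (intro exI[of _ "D \<union> E"]) simp
          then show ?thesis using c by (simp add: F_def meet_closed)
        qed
        show "x \<squnion>\<^bsub>A\<^esub> y \<in> I" if xy: "x \<in> I" "y \<in> I" for x y
        proof -
          obtain D E where DE: "D \<subseteq> I\<^sub>0" "finite D" "sigma_set A x \<subseteq> {T. T \<inter> D \<noteq> {}}"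
            "E \<subseteq> I\<^sub>0" "finite E" "sigma_set A y \<subseteq> {T. T \<inter> E \<noteq> {}}"
            and c: "x \<in> carr A" "y \<in> carr A"
            using xy unfolding I_def by auto
          have "sigma_set A (x \<squnion>\<^bsub>A\<^esub> y) \<subseteq> {T. T \<inter> (D \<union> E) \<noteq> {}}"
            using DE(3,6) c by (auto simp: sigma_set_eq prime_filterD(6) Int_Un_distrib)
          then have "\<exists>E\<subseteq>I\<^sub>0. finite E \<and> sigma_set A (x \<squnion>\<^bsub>A\<^esub> y) \<subseteq> {T. T \<inter> E \<noteq> {}}"
            using DE by (intro exI[of _ "D \<union> E"]) simp
          then show ?thesis using c by (simp add: I_def join_closed)
        qed
        show "\<not> x \<sqsubseteq>\<^bsub>A\<^esub> y" if xy: "x \<in> F" "y \<in> I" for x y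
        proof
          assume le: "x \<sqsubseteq>\<^bsub>A\<^esub> y"
          obtain D E where DE: "D \<subseteq> F\<^sub>0" "finite D" "{T \<in> ?X. D \<subseteq> T} \<subseteq> sigma_set A x"
            "E \<subseteq> I\<^sub>0" "finite E" "sigma_set A y \<subseteq> {T. T \<inter> E \<noteq> {}}"
            and c: "x \<in> carr A" "y \<in> carr A"
            using xy unfolding F_def I_def by auto
          have "sigma_set A x \<subseteq> sigma_set A y"
            using le c prime_filterD(4) unfolding sigma_set_eq by blast
          then have hit: "T \<inter> E \<noteq> {}" if "T \<in> ?X" "D \<subseteq> T" for T
            using DE(3,6) that by blast
          \<comment> \<open>Every prime filter omits an element of \<open>D\<close> or contains one
            of \<open>E\<close>; the corresponding members of \<open>C\<close> form a finite
            subcover.\<close>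
          let ?C = "(\<lambda>a. ?X - sigma_set A a) ` D \<union> sigma_set A ` E"
          have "?X \<subseteq> \<Union>?C"
            using hit by (fastforce simp: sigma_set_def)
          moreover have "\<Union>?C \<subseteq> ?X" by (auto simp: sigma_set_def)
          ultimately have "\<Union>?C = topspace (topo (Phi A))"
            unfolding pts_Phi[OF assms] by (rule equalityI[rotated])
          moreover have "?C \<subseteq> C" using DE(1,4) by (auto simp: F\<^sub>0_def I\<^sub>0_def)
          moreover have "finite ?C" using DE(2,5) by simp
          ultimately have "finite ?C \<and> ?C \<subseteq> C \<and> \<Union>?C = topspace (topo (Phi A))"
            by (intro conjI)
          then show False using no by (metis (no_types, lifting))
        qed
      qed
      then obtain T where T: "prime_filter A T" "F \<subseteq> T" "T \<inter> I = {}" by blast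
      then have "T \<in> \<Union>C" using C(2) pts_Phi[OF assms] by (simp add: prime_filters_def)
      then obtain U where U: "U \<in> C" "T \<in> U" by blast
      then consider a where "a \<in> carr A" "U = sigma_set A a" | a where "a \<in> carr A" "U = ?X - sigma_set A a"
        using C(1) by blast
      then show False
      proof cases
        case 1
        then have "a \<in> I"
          using U unfolding I_def I\<^sub>0_def by (auto simp: sigma_set_def intro!: exI[of _ "{a}"])
        then show False using T(3) U(2) 1 by (auto simp: sigma_set_def)
      next
        case 2
        then have "a \<in> F"
          using U unfolding F_def F\<^sub>0_def by (auto simp: sigma_set_def intro!: exI[of _ "{a}"])
        then show False using T(1,2) U(2) 2 by (auto simp: sigma_set_iff)
      qed
    qed
  qed
qed

lemma sigma_set_clopen_upset:
  assumes "tDL A" "a \<in> carr A" shows "sigma_set A a \<in> clopen_upsets (Phi A)"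
proof -
  have "openin (topo (Phi A)) (sigma_set A a)" "openin (topo (Phi A)) (prime_filters A - sigma_set A a)"
    using assms(2) by (auto simp: Phi_def intro: topology_generated_by_Basis)
  moreover have "sigma_set A a \<subseteq> prime_filters A" by (auto simp: sigma_set_def)
  ultimately show ?thesis
    by (auto simp: clopen_upsets_def upset_def closedin_def pts_Phi[OF assms(1)] Phi_leq_iff sigma_set_iff)
qed

lemma Phi_priestley:
  assumes "tDL A" shows "priestley_space (Phi A)"
proof
  show "compact_space (topo (Phi A))" by (rule Phi_compact[OF assms])
  show "partial_order_on (pts (Phi A)) (leq (Phi A))"
    by (auto simp: order_on_defs refl_on_def trans_def antisym_def Phi_leq_iff pts_Phi[OF assms] prime_filters_def)
  fix S T assume "S \<in> pts (Phi A)" "T \<in> pts (Phi A)" "(S, T) \<notin> leq (Phi A)"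
  then obtain a where "prime_filter A S" "a \<in> S" "a \<notin> T"
    by (auto simp: Phi_leq_iff pts_Phi[OF assms] prime_filters_def)
  moreover from this have "a \<in> carr A" by (auto simp: prime_filter_def)
  ultimately show "\<exists>U\<in>clopen_upsets (Phi A). S \<in> U \<and> T \<notin> U"
    using sigma_set_clopen_upset[OF assms] by (metis sigma_set_iff)
qed

text \<open>The modal equations are the four \<open>_iff_canon_rel\<close> lemmas read as set
  equations. They give both the homomorphism property of \<open>\<sigma>\<close> and (tPS3) for the
  dual space.\<close>

lemma sigma_set_hom:
  assumes "tDL A"
  shows "sigma_set A (lzero A) = {}" "sigma_set A (lone A) = prime_filters A"
    and "\<lbrakk>a \<in> carr A; b \<in> carr A\<rbrakk> \<Longrightarrow> sigma_set A (meet A a b) = sigma_set A a \<inter> sigma_set A b"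
    and "\<lbrakk>a \<in> carr A; b \<in> carr A\<rbrakk> \<Longrightarrow> sigma_set A (join A a b) = sigma_set A a \<union> sigma_set A b"
    and "a \<in> carr A \<Longrightarrow> sigma_set A (opG A a) = G_op (prime_filters A) (rel (Phi A)) (sigma_set A a)"
    and "a \<in> carr A \<Longrightarrow> sigma_set A (opH A a) = H_op (prime_filters A) (rel (Phi A)) (sigma_set A a)"
    and "a \<in> carr A \<Longrightarrow> sigma_set A (opF A a) = F_op (prime_filters A) (rel (Phi A)) (sigma_set A a)"
    and "a \<in> carr A \<Longrightarrow> sigma_set A (opP A a) = P_op (prime_filters A) (rel (Phi A)) (sigma_set A a)"
proof -
  interpret tDL A by fact
  show "sigma_set A \<zero>\<^bsub>A\<^esub> = {}" "sigma_set A \<one>\<^bsub>A\<^esub> = prime_filters A"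
    by (auto simp: sigma_set_iff prime_filters_def dest: prime_filterD(2) intro: prime_filterD(3))
  show "sigma_set A (a \<sqinter>\<^bsub>A\<^esub> b) = sigma_set A a \<inter> sigma_set A b"
    "sigma_set A (a \<squnion>\<^bsub>A\<^esub> b) = sigma_set A a \<union> sigma_set A b" if "a \<in> carr A" "b \<in> carr A"
    using that by (auto simp: sigma_set_iff prime_filterD(5,6))
  assume a: "a \<in> carr A"
  show "sigma_set A (opG A a) = G_op (prime_filters A) (rel (Phi A)) (sigma_set A a)"
    using G_iff_canon_rel[OF _ a] by (auto simp: sigma_set_eq G_op_def prime_filters_def Phi_rel_iff Image_singleton subset_iff)
  show "sigma_set A (opH A a) = H_op (prime_filters A) (rel (Phi A)) (sigma_set A a)"
    using H_iff_canon_rel[OF _ a] by (auto simp: sigma_set_eq H_op_def prime_filters_def Phi_rel_iff Image_singleton subset_iff)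
  show "sigma_set A (opF A a) = F_op (prime_filters A) (rel (Phi A)) (sigma_set A a)"
    using F_iff_canon_rel[OF _ a] by (auto simp: sigma_set_eq F_op_def prime_filters_def Phi_rel_iff Image_singleton subset_iff)
  show "sigma_set A (opP A a) = P_op (prime_filters A) (rel (Phi A)) (sigma_set A a)"
    using P_iff_canon_rel[OF _ a] by (auto simp: sigma_set_eq P_op_def prime_filters_def Phi_rel_iff Image_singleton subset_iff)
qed

text \<open>Surjectivity of \<open>\<sigma>\<close>: the sets \<open>sigma_set A a\<close> form a
  sublattice, and an element of \<open>S\<close> outside \<open>T\<close> separates \<open>S\<close>
  from \<open>T\<close>.\<close>

lemma clopen_upsets_Phi:
  assumes "tDL A" shows "clopen_upsets (Phi A) = sigma_set A ` carr A"
proof -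
  interpret tDL A by fact
  interpret X: priestley_space "Phi A" by (rule Phi_priestley[OF assms])
  note hom = sigma_set_hom[OF assms]
  have "sigma_set A ` carr A = clopen_upsets (Phi A)"
  proof (rule X.separating_sublattice_eq_clopen_upsets)
    show "sigma_set A ` carr A \<subseteq> clopen_upsets (Phi A)"
      using sigma_set_clopen_upset[OF assms] by blast
    show "{} \<in> sigma_set A ` carr A" using hom(1) zero_closed by (metis imageI)
    show "pts (Phi A) \<in> sigma_set A ` carr A"
      using hom(2) one_closed pts_Phi[OF assms] by (metis imageI)
    show "U \<union> V \<in> sigma_set A ` carr A" if "U \<in> sigma_set A ` carr A" "V \<in> sigma_set A ` carr A" for U V
      using that by (auto simp: join_closed simp flip: hom(4))
    show "U \<inter> V \<in> sigma_set A ` carr A" if "U \<in> sigma_set A ` carr A" "V \<in> sigma_set A ` carr A" for U V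
      using that by (auto simp: meet_closed simp flip: hom(3))
    fix S T assume "S \<in> pts (Phi A)" "T \<in> pts (Phi A)" "(S, T) \<notin> leq (Phi A)"
    then obtain a where "prime_filter A S" "a \<in> S" "a \<notin> T"
      by (auto simp: Phi_leq_iff pts_Phi[OF assms] prime_filters_def)
    moreover from this have "a \<in> carr A" by (auto simp: prime_filter_def)
    ultimately show "\<exists>U\<in>sigma_set A ` carr A. S \<in> U \<and> T \<notin> U"
      by (auto simp: sigma_set_iff)
  qed
  then show ?thesis by simp
qed

lemma Phi_tPS:
  assumes "tDL A" shows "tPS (Phi A)"
proof -
  interpret tDL A by fact
  interpret priestley_space "Phi A" by (rule Phi_priestley[OF assms])
  note pts = pts_Phi[OF assms] and hom = sigma_set_hom[OF assms]
  show ?thesis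
  proof
    show "rel (Phi A) \<subseteq> pts (Phi A) \<times> pts (Phi A)"
      by (auto simp: Phi_rel_iff pts prime_filters_def)
    fix S assume "S \<in> pts (Phi A)"
    then have S: "prime_filter A S" by (simp add: pts prime_filters_def)
    have cl: "closedin (topo (Phi A)) (sigma_set A a)"
      "closedin (topo (Phi A)) (prime_filters A - sigma_set A a)" if "a \<in> carr A" for a
      using sigma_set_clopen_upset[OF assms that] pts by (auto simp: clopen_upsets_def openin_closedin_eq)
    \<comment> \<open>Each inclusion in \<open>canon_rel\<close> is a conjunction of conditions on
      membership of single elements, that is, an intersection of subbasic closed sets. Listing the
      whole space makes the family visibly nonempty and keeps its intersection among the
      points.\<close>
    define \<K> where "\<K> = {prime_filters A} \<union> sigma_set A ` {a \<in> carr A. opG A a \<in> S} \<union>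
        (\<lambda>a. prime_filters A - sigma_set A a) ` {a \<in> carr A. opF A a \<notin> S}"
    have "rel (Phi A) `` {S} = \<Inter>\<K>"
    proof (rule set_eqI)
      fix T
      have "T \<in> rel (Phi A) `` {S} \<longleftrightarrow> prime_filter A T \<and>
          (\<forall>a\<in>carr A. opG A a \<in> S \<longrightarrow> a \<in> T) \<and> (\<forall>a\<in>carr A. opF A a \<notin> S \<longrightarrow> a \<notin> T)"
        using S prime_filterD(1)[of T] by (auto simp: Phi_rel_iff canon_rel_def)
      moreover have "T \<in> \<Inter>\<K> \<longleftrightarrow> prime_filter A T \<and>
          (\<forall>a\<in>carr A. opG A a \<in> S \<longrightarrow> a \<in> T) \<and> (\<forall>a\<in>carr A. opF A a \<notin> S \<longrightarrow> a \<notin> T)"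
        by (simp add: \<K>_def ball_Un sigma_set_iff prime_filters_def) blast
      ultimately show "T \<in> rel (Phi A) `` {S} \<longleftrightarrow> T \<in> \<Inter>\<K>"
        by (simp only:)
    qed
    moreover have "closedin (topo (Phi A)) (\<Inter>\<K>)"
    proof (rule closedin_Inter)
      show "\<K> \<noteq> {}" by (simp add: \<K>_def)
      have top: "closedin (topo (Phi A)) (prime_filters A)"
        using closedin_topspace[of "topo (Phi A)"] by (simp add: pts)
      fix U assume "U \<in> \<K>"
      then have "U = prime_filters A \<or> (\<exists>a\<in>carr A. U = sigma_set A a \<or> U = prime_filters A - sigma_set A a)"
        unfolding \<K>_def by blast
      then show "closedin (topo (Phi A)) U"
        using cl top by metis
    qed
    ultimately show "closedin (topo (Phi A)) (rel (Phi A) `` {S})" by simp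
    show "rel (Phi A) `` {S} = leq (Phi A) `` (rel (Phi A) `` {S}) \<inter> (leq (Phi A))\<inverse> `` (rel (Phi A) `` {S})"
    proof
      show "rel (Phi A) `` {S} \<subseteq> leq (Phi A) `` (rel (Phi A) `` {S}) \<inter> (leq (Phi A))\<inverse> `` (rel (Phi A) `` {S})"
        by (auto simp: Phi_rel_iff Phi_leq_iff)
      show "leq (Phi A) `` (rel (Phi A) `` {S}) \<inter> (leq (Phi A))\<inverse> `` (rel (Phi A) `` {S}) \<subseteq> rel (Phi A) `` {S}"
      proof
        fix T assume "T \<in> leq (Phi A) `` (rel (Phi A) `` {S}) \<inter> (leq (Phi A))\<inverse> `` (rel (Phi A) `` {S})"
        then obtain U V where "canon_rel A S U" "U \<subseteq> T" "prime_filter A T" "canon_rel A S V" "T \<subseteq> V"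
          by (auto simp: Phi_rel_iff Phi_leq_iff)
        \<comment> \<open>The inclusion for \<open>opG\<close> passes from \<open>U\<close> up to
          \<open>T\<close>, the one for \<open>opF\<close> from \<open>V\<close> down to
          \<open>T\<close>.\<close>
        then show "T \<in> rel (Phi A) `` {S}"
          using S unfolding Image_singleton_iff Phi_rel_iff canon_rel_def by blast
      qed
    qed
  next
    fix U assume "U \<in> clopen_upsets (Phi A)"
    then obtain a where a: "a \<in> carr A" "U = sigma_set A a"
      using clopen_upsets_Phi[OF assms] by blast
    show "G_op (pts (Phi A)) (rel (Phi A)) U \<in> clopen_upsets (Phi A)"
      "H_op (pts (Phi A)) (rel (Phi A)) U \<in> clopen_upsets (Phi A)"
      "F_op (pts (Phi A)) (rel (Phi A)) U \<in> clopen_upsets (Phi A)"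
      "P_op (pts (Phi A)) (rel (Phi A)) U \<in> clopen_upsets (Phi A)"
      using a by (simp_all add: pts clopen_upsets_Phi[OF assms] G_closed H_closed F_closed P_closed
          flip: hom(5-8))
  qed
qed

section \<open>Functors on morphisms\<close>

lemma Psi_simps [simp]:
  "carr (Psi X) = clopen_upsets X" "meet (Psi X) = (\<inter>)" "join (Psi X) = (\<union>)"
  "lzero (Psi X) = {}" "lone (Psi X) = pts X"
  "opG (Psi X) = G_op (pts X) (rel X)" "opH (Psi X) = H_op (pts X) (rel X)"
  "opF (Psi X) = F_op (pts X) (rel X)" "opP (Psi X) = P_op (pts X) (rel X)"
  by (simp_all add: Psi_def)

lemma Psi_lle [simp]: "lle (Psi X) U V \<longleftrightarrow> U \<subseteq> V"
  by (auto simp: lle_def)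

lemma op_iffs:
  "x \<in> G_op S R U \<longleftrightarrow> x \<in> S \<and> (\<forall>y. (x, y) \<in> R \<longrightarrow> y \<in> U)"
  "x \<in> H_op S R U \<longleftrightarrow> x \<in> S \<and> (\<forall>y. (y, x) \<in> R \<longrightarrow> y \<in> U)"
  "x \<in> F_op S R U \<longleftrightarrow> x \<in> S \<and> (\<exists>y. (x, y) \<in> R \<and> y \<in> U)"
  "x \<in> P_op S R U \<longleftrightarrow> x \<in> S \<and> (\<exists>y. (y, x) \<in> R \<and> y \<in> U)"
  by (auto simp: G_op_def H_op_def F_op_def P_op_def)

text \<open>(t1) to (t8) hold for the operators of any relation on a set; (tPS3) supplies closure of
  the clopen up-sets under them.\<close>

lemma Psi_tDL:
  assumes "tPS X" shows "tDL (Psi X)"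
proof -
  interpret tPS X by fact
  interpret L: bounded_distrib_lattice "Psi X"
    using clopen_upsets_lattice clopen_upset_subset by unfold_locales auto
  have rel: "(x, y) \<in> rel X \<Longrightarrow> x \<in> pts X \<and> y \<in> pts X" for x y
    using rel_on by auto
  show ?thesis
  proof unfold_locales
    fix U V assume "U \<in> carr (Psi X)" "V \<in> carr (Psi X)"
    show "lle (Psi X) (opG (Psi X) (join (Psi X) U V)) (join (Psi X) (opG (Psi X) U) (opF (Psi X) V))"
      "lle (Psi X) (opH (Psi X) (join (Psi X) U V)) (join (Psi X) (opH (Psi X) U) (opP (Psi X) V))"
      "lle (Psi X) (meet (Psi X) (opG (Psi X) U) (opF (Psi X) V)) (opF (Psi X) (meet (Psi X) U V))"
      "lle (Psi X) (meet (Psi X) (opH (Psi X) U) (opP (Psi X) V)) (opP (Psi X) (meet (Psi X) U V))"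
      unfolding Psi_lle Psi_simps subset_iff op_iffs Un_iff Int_iff by blast+
  next
    fix U assume "U \<in> carr (Psi X)"
    then have U: "U \<subseteq> pts X" by (simp add: clopen_upset_subset)
    show "lle (Psi X) U (opG (Psi X) (opP (Psi X) U))" "lle (Psi X) U (opH (Psi X) (opF (Psi X) U))"
      "lle (Psi X) (opP (Psi X) (opG (Psi X) U)) U" "lle (Psi X) (opF (Psi X) (opH (Psi X) U)) U"
      using U rel by (auto simp: op_iffs)
  next
    show "opG (Psi X) (lone (Psi X)) = lone (Psi X)" "opH (Psi X) (lone (Psi X)) = lone (Psi X)"
      using rel by (auto simp: op_iffs)
    show "opF (Psi X) (lzero (Psi X)) = lzero (Psi X)" "opP (Psi X) (lzero (Psi X)) = lzero (Psi X)"
      by (auto simp: op_iffs)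
  next
    fix U assume "U \<in> carr (Psi X)"
    then show "opG (Psi X) U \<in> carr (Psi X)" "opH (Psi X) U \<in> carr (Psi X)"
      "opF (Psi X) U \<in> carr (Psi X)" "opP (Psi X) U \<in> carr (Psi X)"
      by (simp_all add: tPS3)
  next
    fix U V
    show "opG (Psi X) (meet (Psi X) U V) = meet (Psi X) (opG (Psi X) U) (opG (Psi X) V)"
      "opH (Psi X) (meet (Psi X) U V) = meet (Psi X) (opH (Psi X) U) (opH (Psi X) V)"
      "opF (Psi X) (join (Psi X) U V) = join (Psi X) (opF (Psi X) U) (opF (Psi X) V)"
      "opP (Psi X) (join (Psi X) U V) = join (Psi X) (opP (Psi X) U) (opP (Psi X) V)"
      by (auto simp: op_iffs)
  qed
qed

lemma tPS_homD:
  assumes "f \<in> tPS_hom X Y"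
  shows "f \<in> pts X \<rightarrow>\<^sub>E pts Y" "continuous_map (topo X) (topo Y) f"
    and "x \<in> pts X \<Longrightarrow> f x \<in> pts Y"
    and "(x, y) \<in> leq X \<Longrightarrow> (f x, f y) \<in> leq Y"
  using assms by (auto simp: tPS_hom_def)

lemma Psi_map_hom:
  assumes "tPS X" "tPS Y" "f \<in> tPS_hom X Y"
  shows "Psi_map X Y f \<in> tDL_hom (Psi Y) (Psi X)"
proof -
  interpret X: tPS X by fact
  interpret Y: tPS Y by fact
  note f = tPS_homD[OF assms(3)]
  have relX: "(x, y) \<in> rel X \<Longrightarrow> x \<in> pts X \<and> y \<in> pts X" for x y
    using X.rel_on by auto
  have relY: "(x, y) \<in> rel Y \<Longrightarrow> x \<in> pts Y \<and> y \<in> pts Y" for x y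
    using Y.rel_on by auto
  have clopen: "{x \<in> pts X. f x \<in> U} \<in> clopen_upsets X" if U: "U \<in> clopen_upsets Y" for U
  proof -
    have "y \<in> pts X \<and> f y \<in> U" if "f x \<in> U" "(x, y) \<in> leq X" for x y
      using that Y.clopen_upset_leq[OF U] f(4) X.leq_on by blast
    moreover have "openin (topo X) {x \<in> pts X. f x \<in> U}" "closedin (topo X) {x \<in> pts X. f x \<in> U}"
      using U openin_continuous_map_preimage[OF f(2)] closedin_continuous_map_preimage[OF f(2)]
      by (auto simp: clopen_upsets_def)
    ultimately show ?thesis by (auto simp: clopen_upsets_def upset_def)
  qed
  have G: "{x \<in> pts X. f x \<in> G_op (pts Y) (rel Y) U} = G_op (pts X) (rel X) {x \<in> pts X. f x \<in> U}"
    and F: "{x \<in> pts X. f x \<in> F_op (pts Y) (rel Y) U} = F_op (pts X) (rel X) {x \<in> pts X. f x \<in> U}"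
    and H: "{x \<in> pts X. f x \<in> H_op (pts Y) (rel Y) U} = H_op (pts X) (rel X) {x \<in> pts X. f x \<in> U}"
    and P: "{x \<in> pts X. f x \<in> P_op (pts Y) (rel Y) U} = P_op (pts X) (rel X) {x \<in> pts X. f x \<in> U}"
    if U: "U \<in> clopen_upsets Y" for U
  proof -
    note up = Y.clopen_upset_leq[OF U]
    have fwd: "(\<forall>y. (f x, y) \<in> rel Y \<longrightarrow> y \<in> U) \<longleftrightarrow> (\<forall>z. (x, z) \<in> rel X \<longrightarrow> f z \<in> U)"
      "(\<exists>y. (f x, y) \<in> rel Y \<and> y \<in> U) \<longleftrightarrow> (\<exists>z. (x, z) \<in> rel X \<and> f z \<in> U)"
      "(\<forall>y. (y, f x) \<in> rel Y \<longrightarrow> y \<in> U) \<longleftrightarrow> (\<forall>z. (z, x) \<in> rel X \<longrightarrow> f z \<in> U)"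
      "(\<exists>y. (y, f x) \<in> rel Y \<and> y \<in> U) \<longleftrightarrow> (\<exists>z. (z, x) \<in> rel X \<and> f z \<in> U)"
      if x: "x \<in> pts X" for x
      using tPS_hom_f1[OF assms(3)] tPS_hom_f2[OF assms(3) x] tPS_hom_f3[OF assms(3) x] relX relY up x
      by metis+
    have *: "(f x \<in> G_op (pts Y) (rel Y) U \<longleftrightarrow> x \<in> G_op (pts X) (rel X) {x \<in> pts X. f x \<in> U}) \<and>
        (f x \<in> F_op (pts Y) (rel Y) U \<longleftrightarrow> x \<in> F_op (pts X) (rel X) {x \<in> pts X. f x \<in> U}) \<and>
        (f x \<in> H_op (pts Y) (rel Y) U \<longleftrightarrow> x \<in> H_op (pts X) (rel X) {x \<in> pts X. f x \<in> U}) \<and>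
        (f x \<in> P_op (pts Y) (rel Y) U \<longleftrightarrow> x \<in> P_op (pts X) (rel X) {x \<in> pts X. f x \<in> U})"
      if x: "x \<in> pts X" for x
      using x f(3)[OF x] unfolding op_iffs fwd[OF x] mem_Collect_eq by (auto dest: relX)
    have preimage_eqI: "{x \<in> pts X. f x \<in> Q} = Q'"
      if "\<And>x. x \<in> pts X \<Longrightarrow> f x \<in> Q \<longleftrightarrow> x \<in> Q'" "Q' \<subseteq> pts X" for Q Q'
      using that by blast
    show "{x \<in> pts X. f x \<in> G_op (pts Y) (rel Y) U} = G_op (pts X) (rel X) {x \<in> pts X. f x \<in> U}"
      "{x \<in> pts X. f x \<in> F_op (pts Y) (rel Y) U} = F_op (pts X) (rel X) {x \<in> pts X. f x \<in> U}"
      "{x \<in> pts X. f x \<in> H_op (pts Y) (rel Y) U} = H_op (pts X) (rel X) {x \<in> pts X. f x \<in> U}"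
      "{x \<in> pts X. f x \<in> P_op (pts Y) (rel Y) U} = P_op (pts X) (rel X) {x \<in> pts X. f x \<in> U}"
      by (rule preimage_eqI, simp add: *, simp add: op_iffs subset_iff)+
  qed
  have eq: "U \<in> clopen_upsets Y \<Longrightarrow> Psi_map X Y f U = {x \<in> pts X. f x \<in> U}" for U
    by (simp add: Psi_map_def)
  show ?thesis
    unfolding tDL_hom_def Psi_simps
  proof (intro CollectI conjI ballI)
    show "Psi_map X Y f \<in> clopen_upsets Y \<rightarrow>\<^sub>E clopen_upsets X"
      using clopen by (simp add: Psi_map_def)
    show "Psi_map X Y f {} = {}" "Psi_map X Y f (pts Y) = pts X"
      using f(3) by (auto simp: eq Y.clopen_upsets_lattice)
  next
    fix U V assume UV: "U \<in> clopen_upsets Y" "V \<in> clopen_upsets Y"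
    then show "Psi_map X Y f (U \<inter> V) = Psi_map X Y f U \<inter> Psi_map X Y f V"
      "Psi_map X Y f (U \<union> V) = Psi_map X Y f U \<union> Psi_map X Y f V"
      by (auto simp: eq Y.clopen_upsets_lattice)
  next
    fix U assume U: "U \<in> clopen_upsets Y"
    show "Psi_map X Y f (G_op (pts Y) (rel Y) U) = G_op (pts X) (rel X) (Psi_map X Y f U)"
      "Psi_map X Y f (H_op (pts Y) (rel Y) U) = H_op (pts X) (rel X) (Psi_map X Y f U)"
      "Psi_map X Y f (F_op (pts Y) (rel Y) U) = F_op (pts X) (rel X) (Psi_map X Y f U)"
      "Psi_map X Y f (P_op (pts Y) (rel Y) U) = P_op (pts X) (rel X) (Psi_map X Y f U)"
      using Y.tPS3[OF U] by (simp_all add: eq U G F H P)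
  qed
qed

section \<open>The functor \<open>Phi\<close> on homomorphisms\<close>

lemma tDL_homD:
  assumes "h \<in> tDL_hom A B"
  shows "h \<in> carr A \<rightarrow>\<^sub>E carr B" "h (lzero A) = lzero B" "h (lone A) = lone B"
    and "x \<in> carr A \<Longrightarrow> h x \<in> carr B"
    and "\<lbrakk>x \<in> carr A; y \<in> carr A\<rbrakk> \<Longrightarrow> h (meet A x y) = meet B (h x) (h y)"
    and "\<lbrakk>x \<in> carr A; y \<in> carr A\<rbrakk> \<Longrightarrow> h (join A x y) = join B (h x) (h y)"
    and "x \<in> carr A \<Longrightarrow> h (opG A x) = opG B (h x)" "x \<in> carr A \<Longrightarrow> h (opH A x) = opH B (h x)"
    and "x \<in> carr A \<Longrightarrow> h (opF A x) = opF B (h x)" "x \<in> carr A \<Longrightarrow> h (opP A x) = opP B (h x)"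
  using assms by (auto simp: tDL_hom_def)

lemma tDL_hom_lattice_rev:
  "h \<in> tDL_hom A B \<Longrightarrow> h \<in> tDL_hom (lattice_rev A) (lattice_rev B)"
  by (simp add: tDL_hom_def)

lemma prime_filter_preimage:
  assumes "tDL A" "tDL B" "h \<in> tDL_hom A B" "prime_filter B S"
  shows "prime_filter A {a \<in> carr A. h a \<in> S}"
proof -
  interpret A: tDL A by fact
  interpret B: tDL B by fact
  note h = tDL_homD[OF assms(3)] and S = B.prime_filterD[OF assms(4)]
  have up: "h y \<in> S" if "x \<in> carr A" "h x \<in> S" "y \<in> carr A" "lle A x y" for x y
  proof -
    have "lle B (h x) (h y)" using that h(5)[of x y] by (simp add: lle_def)
    then show ?thesis using that S(4) h(4) by blast
  qed
  show ?thesis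
    unfolding prime_filter_def
  proof (intro conjI ballI impI)
    show "{a \<in> carr A. h a \<in> S} \<noteq> {}"
      using h(3) S(3) A.one_closed by auto
    show "{a \<in> carr A. h a \<in> S} \<noteq> carr A"
    proof -
      have "h (lzero A) \<notin> S" using h(2) S(2) by simp
      then show ?thesis using A.zero_closed by blast
    qed
    show "y \<in> {a \<in> carr A. h a \<in> S}"
      if "x \<in> {a \<in> carr A. h a \<in> S}" "y \<in> carr A" "lle A x y" for x y
      using that up by blast
    show "meet A x y \<in> {a \<in> carr A. h a \<in> S}"
      if "x \<in> {a \<in> carr A. h a \<in> S}" "y \<in> {a \<in> carr A. h a \<in> S}" for x y
      using that by (simp add: h(4,5) S(5) A.meet_closed)
    show "x \<in> {a \<in> carr A. h a \<in> S} \<or> y \<in> {a \<in> carr A. h a \<in> S}"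
      if "x \<in> carr A" "y \<in> carr A" "join A x y \<in> {a \<in> carr A. h a \<in> S}" for x y
      using that by (simp add: h(4,6) S(6))
  qed blast
qed

lemma canon_rel_preimage:
  assumes "tDL A" "h \<in> tDL_hom A B" "canon_rel B S T"
  shows "canon_rel A {a \<in> carr A. h a \<in> S} {a \<in> carr A. h a \<in> T}"
proof -
  interpret A: tDL A by fact
  show ?thesis
    using assms(3) tDL_homD[OF assms(2)] unfolding canon_rel_def
    by (auto simp: A.F_closed subset_iff)
qed

text \<open>The back condition for the dual of \<open>h\<close>. \<open>W\<close> is a successor of
  \<open>S\<close> above the image of \<open>T\<close>, which is closed under meets;
  \<open>Z\<close> is a successor avoiding the image of the complement of \<open>T\<close>, which is
  closed under joins because \<open>T\<close> is prime.\<close>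

lemma canon_rel_preimage_bounds:
  assumes "tDL A" "tDL B" "h \<in> tDL_hom A B" "prime_filter B S" "prime_filter A T"
    and R: "canon_rel A {a \<in> carr A. h a \<in> S} T"
  shows "\<exists>Z W. prime_filter B Z \<and> prime_filter B W \<and> canon_rel B S Z \<and> canon_rel B S W \<and>
    {a \<in> carr A. h a \<in> Z} \<subseteq> T \<and> T \<subseteq> {a \<in> carr A. h a \<in> W}"
proof -
  interpret A: tDL A by fact
  interpret B: tDL B by fact
  note h = tDL_homD[OF assms(3)] and T = A.prime_filterD[OF assms(5)]
  have TA: "x \<in> T \<Longrightarrow> x \<in> carr A" for x using T(1) by blast
  have "\<exists>W. prime_filter B W \<and> canon_rel B S W \<and> h ` T \<subseteq> W"
  proof (rule B.canon_rel_above[OF assms(4)])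
    show "h ` T \<subseteq> carr B" using h(4) TA by blast
    show "h ` T \<noteq> {}" using T(3) by blast
    show "meet B x y \<in> h ` T" if xy: "x \<in> h ` T" "y \<in> h ` T" for x y
    proof -
      obtain a b where ab: "a \<in> T" "b \<in> T" "x = h a" "y = h b" using xy by blast
      then have "meet B x y = h (meet A a b)" "meet A a b \<in> T"
        using h(5) T(5) TA by auto
      then show ?thesis by blast
    qed
    show "opF B x \<in> S" if "x \<in> h ` T" for x
      using that R TA h(9) unfolding canon_rel_def by auto
  qed
  moreover have "\<exists>Z. prime_filter B Z \<and> canon_rel B S Z \<and> Z \<inter> h ` (carr A - T) = {}"
  proof (rule B.canon_rel_avoiding[OF assms(4)])
    show "h ` (carr A - T) \<subseteq> carr B" using h(4) by blast
    show "h ` (carr A - T) \<noteq> {}" using T(2) A.zero_closed by blast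
    show "join B x y \<in> h ` (carr A - T)" if xy: "x \<in> h ` (carr A - T)" "y \<in> h ` (carr A - T)" for x y
    proof -
      obtain a b where ab: "a \<in> carr A - T" "b \<in> carr A - T" "x = h a" "y = h b" using xy by blast
      then have "join B x y = h (join A a b)" "join A a b \<in> carr A - T"
        using h(6) T(6) A.join_closed by auto
      then show ?thesis by blast
    qed
    show "opG B x \<notin> S" if x: "x \<in> h ` (carr A - T)" for x
    proof -
      obtain a where a: "a \<in> carr A" "a \<notin> T" "x = h a" using x by blast
      then have "opG A a \<in> carr A" "opG B x = h (opG A a)" using h(7) A.G_closed by auto
      then show ?thesis using R a unfolding canon_rel_def by auto
    qed
  qed
  ultimately obtain Z W where "prime_filter B W" "canon_rel B S W" "h ` T \<subseteq> W"
    and "prime_filter B Z" "canon_rel B S Z" "Z \<inter> h ` (carr A - T) = {}" by blast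
  moreover from this have "{a \<in> carr A. h a \<in> Z} \<subseteq> T" "T \<subseteq> {a \<in> carr A. h a \<in> W}"
    using TA by blast+
  ultimately show ?thesis by blast
qed

lemma Phi_map_hom:
  assumes "tDL A" "tDL B" "h \<in> tDL_hom A B"
  shows "Phi_map A B h \<in> tPS_hom (Phi B) (Phi A)"
proof -
  interpret A: tDL A by fact
  interpret B: tDL B by fact
  note ptsA = pts_Phi[OF assms(1)] and ptsB = pts_Phi[OF assms(2)]
  note pre = prime_filter_preimage[OF assms]
  have pf: "S \<in> pts (Phi B) \<longleftrightarrow> prime_filter B S" for S
    by (simp add: ptsB prime_filters_def)
  have pfA: "S \<in> pts (Phi A) \<longleftrightarrow> prime_filter A S" for S
    by (simp add: ptsA prime_filters_def)
  have eq: "Phi_map A B h S = {a \<in> carr A. h a \<in> S}" if "prime_filter B S" for S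
    using that by (simp add: Phi_map_def prime_filters_def)
  have ext: "Phi_map A B h \<in> pts (Phi B) \<rightarrow>\<^sub>E pts (Phi A)"
    using pre by (auto simp: Phi_map_def ptsA ptsB prime_filters_def)
  have cont: "continuous_map (topo (Phi B)) (topo (Phi A)) (Phi_map A B h)"
  proof -
    let ?B = "sigma_set A ` carr A \<union> (\<lambda>a. prime_filters A - sigma_set A a) ` carr A"
    have "continuous_map (topo (Phi B)) (topology_generated_by ?B) (Phi_map A B h)"
    proof (rule continuous_on_generated_topo)
      fix U assume "U \<in> ?B"
      then obtain a where a: "a \<in> carr A" "U = sigma_set A a \<or> U = prime_filters A - sigma_set A a"
        by blast
      \<comment> \<open>Continuity is checked on the subbase: the preimage of the basic set of
        \<open>a\<close> is the basic set of \<open>h a\<close>.\<close>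
      have "Phi_map A B h -` sigma_set A a \<inter> pts (Phi B) = sigma_set B (h a)"
        using a(1) pre by (auto simp: pf eq sigma_set_iff)
      moreover have "Phi_map A B h -` (prime_filters A - sigma_set A a) \<inter> pts (Phi B) =
          pts (Phi B) - sigma_set B (h a)"
        using a(1) pre by (auto simp: pf eq sigma_set_iff prime_filters_def)
      moreover have "sigma_set B (h a) \<in> clopen_upsets (Phi B)"
        using sigma_set_clopen_upset[OF assms(2)] tDL_homD(4)[OF assms(3) a(1)] by blast
      then have "openin (topo (Phi B)) (sigma_set B (h a))"
        "openin (topo (Phi B)) (pts (Phi B) - sigma_set B (h a))"
        by (auto simp: clopen_upsets_def)
      ultimately show "openin (topo (Phi B)) (Phi_map A B h -` U \<inter> topspace (topo (Phi B)))"
        using a(2) by auto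
    next
      have "\<Union>?B = pts (Phi A)" by (simp add: Phi_def)
      then show "Phi_map A B h ` topspace (topo (Phi B)) \<subseteq> \<Union>?B"
        using ext by auto
    qed
    then show ?thesis by (simp add: Phi_def)
  qed
  have f2: "\<exists>Z\<in>rel (Phi B) `` {S}. \<exists>W\<in>rel (Phi B) `` {S}.
      (Phi_map A B h Z, T) \<in> leq (Phi A) \<and> (T, Phi_map A B h W) \<in> leq (Phi A)"
    if ST: "prime_filter B S" "T \<in> rel (Phi A) `` {Phi_map A B h S}" for S T
  proof -
    have T: "prime_filter A T" "canon_rel A {a \<in> carr A. h a \<in> S} T"
      using ST by (auto simp: Phi_rel_iff eq)
    obtain Z W where ZW: "prime_filter B Z" "prime_filter B W" "canon_rel B S Z" "canon_rel B S W"
      "{a \<in> carr A. h a \<in> Z} \<subseteq> T" "T \<subseteq> {a \<in> carr A. h a \<in> W}"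
      using canon_rel_preimage_bounds[OF assms ST(1) T] by blast
    have "Z \<in> rel (Phi B) `` {S}" "W \<in> rel (Phi B) `` {S}"
      using ST ZW by (auto simp: Phi_rel_iff)
    moreover have "(Phi_map A B h Z, T) \<in> leq (Phi A)" "(T, Phi_map A B h W) \<in> leq (Phi A)"
      using ZW(1,2,5,6) T(1) pre by (simp_all add: Phi_leq_iff eq)
    ultimately show ?thesis by blast
  qed
  \<comment> \<open>These are the future bounds for the reversed algebras, between which
    \<open>h\<close> is still a homomorphism; \<open>canon_rel_rev\<close> translates the hypothesis
    and the result.\<close>
  have f3: "\<exists>Z\<in>(rel (Phi B))\<inverse> `` {S}. \<exists>W\<in>(rel (Phi B))\<inverse> `` {S}.
      (Phi_map A B h Z, T) \<in> leq (Phi A) \<and> (T, Phi_map A B h W) \<in> leq (Phi A)"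
    if ST: "prime_filter B S" "T \<in> (rel (Phi A))\<inverse> `` {Phi_map A B h S}" for S T
  proof -
    have T: "prime_filter A T" "canon_rel (lattice_rev A) {a \<in> carr A. h a \<in> S} T"
      using ST A.canon_rel_rev[OF _ pre[OF ST(1)]] by (auto simp: Phi_rel_iff eq)
    obtain Z W where ZW: "prime_filter B Z" "prime_filter B W"
      "canon_rel (lattice_rev B) S Z" "canon_rel (lattice_rev B) S W"
      "{a \<in> carr A. h a \<in> Z} \<subseteq> T" "T \<subseteq> {a \<in> carr A. h a \<in> W}"
      using canon_rel_preimage_bounds[OF A.tDL_lattice_rev B.tDL_lattice_rev
          tDL_hom_lattice_rev[OF assms(3)], of S T] ST(1) T by auto
    have "Z \<in> (rel (Phi B))\<inverse> `` {S}" "W \<in> (rel (Phi B))\<inverse> `` {S}"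
      using ST ZW B.canon_rel_rev[OF _ ST(1)] by (auto simp: Phi_rel_iff)
    moreover have "(Phi_map A B h Z, T) \<in> leq (Phi A)" "(T, Phi_map A B h W) \<in> leq (Phi A)"
      using ZW(1,2,5,6) T(1) pre by (simp_all add: Phi_leq_iff eq)
    ultimately show ?thesis by blast
  qed
  have mono: "(Phi_map A B h S, Phi_map A B h T) \<in> leq (Phi A)" if "(S, T) \<in> leq (Phi B)" for S T
    using that pre by (auto simp: Phi_leq_iff eq)
  have f1: "Phi_map A B h ` (rel (Phi B) `` {S}) \<subseteq> rel (Phi A) `` {Phi_map A B h S}" for S
    using pre canon_rel_preimage[OF assms(1,3)] by (auto simp: Phi_rel_iff eq)
  show ?thesis
    unfolding tPS_hom_def
  proof (intro CollectI conjI ballI allI impI)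
    show "Phi_map A B h \<in> pts (Phi B) \<rightarrow>\<^sub>E pts (Phi A)" by (rule ext)
  qed (use cont mono f1 f2 f3 pf in blast)+
qed

section \<open>The natural isomorphisms\<close>

lemma tDL_isoI:
  assumes "tDL A" "tDL B" "h \<in> tDL_hom A B" "bij_betw h (carr A) (carr B)"
  shows "h \<in> tDL_iso A B"
proof -
  interpret A: tDL A by fact
  interpret B: tDL B by fact
  note h = tDL_homD[OF assms(3)]
  \<comment> \<open>The restriction makes the inverse extensional, as morphisms are required to
    be.\<close>
  define g where "g = restrict (inv_into (carr A) h) (carr B)"
  have gc: "g y \<in> carr A" and hg: "h (g y) = y" if "y \<in> carr B" for y
    using that assms(4) by (auto simp: g_def bij_betw_def inv_into_into f_inv_into_f)
  have gh: "g (h x) = x" if "x \<in> carr A" for x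
    using that assms(4) h(4) by (simp add: g_def bij_betw_def inv_into_f_f)
  have "g \<in> tDL_hom B A"
    unfolding tDL_hom_def
  proof (intro CollectI conjI ballI)
    show "g \<in> carr B \<rightarrow>\<^sub>E carr A" using gc by (auto simp: g_def)
    show "g (lzero B) = lzero A" "g (lone B) = lone A"
      using gh[of "lzero A"] gh[of "lone A"] h(2,3) A.zero_closed A.one_closed by simp_all
  next
    fix x y assume xy: "x \<in> carr B" "y \<in> carr B"
    show "g (meet B x y) = meet A (g x) (g y)"
      using h(5)[OF gc gc] gh[OF A.meet_closed[OF gc gc]] xy by (simp add: hg)
    show "g (join B x y) = join A (g x) (g y)"
      using h(6)[OF gc gc] gh[OF A.join_closed[OF gc gc]] xy by (simp add: hg)
  next
    fix x assume x: "x \<in> carr B"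
    show "g (opG B x) = opG A (g x)" using h(7)[OF gc] gh[OF A.G_closed[OF gc]] x by (simp add: hg)
    show "g (opH B x) = opH A (g x)" using h(8)[OF gc] gh[OF A.H_closed[OF gc]] x by (simp add: hg)
    show "g (opF B x) = opF A (g x)" using h(9)[OF gc] gh[OF A.F_closed[OF gc]] x by (simp add: hg)
    show "g (opP B x) = opP A (g x)" using h(10)[OF gc] gh[OF A.P_closed[OF gc]] x by (simp add: hg)
  qed
  moreover have "tDL_comp A g h = tDL_id A" "tDL_comp B h g = tDL_id B"
    using gh hg by (auto simp: tDL_comp_def tDL_id_def compose_def)
  ultimately show ?thesis
    using assms(3) unfolding tDL_iso_def by blast
qed

text \<open>Injectivity is the separation of elements by prime filters, together with antisymmetry;
  surjectivity is \<open>clopen_upsets_Phi\<close>.\<close>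

lemma sigma_map_iso:
  assumes "tDL A" shows "sigma_map A \<in> tDL_iso A (Psi (Phi A))"
proof (rule tDL_isoI[OF assms Psi_tDL[OF Phi_tPS[OF assms]]])
  interpret tDL A by fact
  note cl = G_closed H_closed F_closed P_closed meet_closed join_closed zero_closed one_closed
  show "sigma_map A \<in> tDL_hom A (Psi (Phi A))"
    unfolding tDL_hom_def Psi_simps pts_Phi[OF assms]
    using sigma_set_clopen_upset[OF assms]
    by (auto simp: sigma_map_def cl sigma_set_hom[OF assms])
  have "inj_on (sigma_set A) (carr A)"
  proof (rule inj_onI)
    fix a b assume ab: "a \<in> carr A" "b \<in> carr A" "sigma_set A a = sigma_set A b"
    then have "prime_filter A T \<Longrightarrow> a \<in> T \<longleftrightarrow> b \<in> T" for T
      using sigma_set_iff by metis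
    then show "a = b"
      using prime_filter_separates ab(1,2) le_antisym by metis
  qed
  then have "bij_betw (sigma_set A) (carr A) (carr (Psi (Phi A)))"
    by (simp add: bij_betw_def clopen_upsets_Phi[OF assms])
  then show "bij_betw (sigma_map A) (carr A) (carr (Psi (Phi A)))"
    by (rule bij_betw_cong[THEN iffD1, rotated]) (simp add: sigma_map_def)
qed

section \<open>Isomorphisms of tense Priestley spaces\<close>

text \<open>Surjectivity provides an exact preimage of \<open>y\<close>, which serves as both bounds
  in (f2) and (f3). Stated separately because it applies to an isomorphism and to its inverse
  alike.\<close>

lemma tPS_hom_of_surj_embedding:
  assumes "tPS X" "tPS Y"
    and "f \<in> pts X \<rightarrow>\<^sub>E pts Y" "f ` pts X = pts Y" "continuous_map (topo X) (topo Y) f"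
    and leq: "\<And>x y. \<lbrakk>x \<in> pts X; y \<in> pts X\<rbrakk> \<Longrightarrow> (f x, f y) \<in> leq Y \<longleftrightarrow> (x, y) \<in> leq X"
    and rel: "\<And>x y. \<lbrakk>x \<in> pts X; y \<in> pts X\<rbrakk> \<Longrightarrow> (f x, f y) \<in> rel Y \<longleftrightarrow> (x, y) \<in> rel X"
  shows "f \<in> tPS_hom X Y"
proof -
  interpret X: tPS X by fact
  interpret Y: tPS Y by fact
  have relX: "(x, y) \<in> rel X \<Longrightarrow> x \<in> pts X \<and> y \<in> pts X" for x y
    using X.rel_on by auto
  have lift: "\<exists>z\<in>pts X. y = f z" if "y \<in> pts Y" for y
    using that assms(4) by blast
  show ?thesis
    unfolding tPS_hom_def
  proof (intro CollectI conjI ballI allI impI)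
    show "(f x, f y) \<in> leq Y" if "(x, y) \<in> leq X" for x y
      using that X.leq_on leq by blast
    show "f ` (rel X `` {x}) \<subseteq> rel Y `` {f x}" for x
      using relX rel by blast
  next
    fix x y assume xy: "x \<in> pts X" "y \<in> pts Y" "y \<in> rel Y `` {f x}"
    obtain z where z: "z \<in> pts X" "y = f z" using lift[OF xy(2)] by blast
    then have "z \<in> rel X `` {x}" "(f z, y) \<in> leq Y" "(y, f z) \<in> leq Y"
      using xy rel Y.leq_refl by auto
    then show "\<exists>z\<in>rel X `` {x}. \<exists>w\<in>rel X `` {x}. (f z, y) \<in> leq Y \<and> (y, f w) \<in> leq Y"
      by blast
  next
    fix x y assume xy: "x \<in> pts X" "y \<in> pts Y" "y \<in> (rel Y)\<inverse> `` {f x}"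
    obtain z where z: "z \<in> pts X" "y = f z" using lift[OF xy(2)] by blast
    then have "z \<in> (rel X)\<inverse> `` {x}" "(f z, y) \<in> leq Y" "(y, f z) \<in> leq Y"
      using xy rel Y.leq_refl by auto
    then show "\<exists>z\<in>(rel X)\<inverse> `` {x}. \<exists>w\<in>(rel X)\<inverse> `` {x}. (f z, y) \<in> leq Y \<and> (y, f w) \<in> leq Y"
      by blast
  qed (use assms in auto)
qed

text \<open>Reflecting the order forces injectivity, and a continuous bijection from a compact space
  to a Hausdorff space has a continuous inverse. That inverse again preserves and reflects order and
  relation.\<close>

lemma tPS_iso_of_surj_embedding:
  assumes X: "tPS X" and Y: "tPS Y"
    and f: "f \<in> pts X \<rightarrow>\<^sub>E pts Y" and surj: "f ` pts X = pts Y"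
    and cont: "continuous_map (topo X) (topo Y) f"
    and leq: "\<And>x y. \<lbrakk>x \<in> pts X; y \<in> pts X\<rbrakk> \<Longrightarrow> (f x, f y) \<in> leq Y \<longleftrightarrow> (x, y) \<in> leq X"
    and rel: "\<And>x y. \<lbrakk>x \<in> pts X; y \<in> pts X\<rbrakk> \<Longrightarrow> (f x, f y) \<in> rel Y \<longleftrightarrow> (x, y) \<in> rel X"
  shows "f \<in> tPS_iso X Y"
proof -
  interpret X: tPS X by fact
  interpret Y: tPS Y by fact
  have "inj_on f (pts X)"
  proof (rule inj_onI)
    fix x y assume xy: "x \<in> pts X" "y \<in> pts X" "f x = f y"
    then have "(f x, f y) \<in> leq Y" "(f y, f x) \<in> leq Y"
      using f Y.leq_refl by auto
    then show "x = y" using xy leq X.leq_antisym by blast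
  qed
  then have "homeomorphic_map (topo X) (topo Y) f"
    using continuous_imp_homeomorphic_map[OF cont X.compact Y.Hausdorff surj] by blast
  then obtain g where g: "continuous_map (topo Y) (topo X) g"
    "\<And>x. x \<in> pts X \<Longrightarrow> g (f x) = x" "\<And>y. y \<in> pts Y \<Longrightarrow> f (g y) = y"
    unfolding homeomorphic_map_maps homeomorphic_maps_def by blast
  define g' where "g' = restrict g (pts Y)"
  have gY: "g y \<in> pts X" if "y \<in> pts Y" for y
    using that g(1) continuous_map_image_subset_topspace by fastforce
  have fX: "x \<in> pts X \<Longrightarrow> f x \<in> pts Y" for x using f by auto
  have g': "y \<in> pts Y \<Longrightarrow> g' y = g y" for y by (simp add: g'_def)
  have "g' \<in> tPS_hom Y X"
  proof (rule tPS_hom_of_surj_embedding[OF Y X])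
    show "g' \<in> pts Y \<rightarrow>\<^sub>E pts X" using gY by (simp add: g'_def)
    show "g' ` pts Y = pts X"
    proof
      show "g' ` pts Y \<subseteq> pts X" using gY g' by auto
      show "pts X \<subseteq> g' ` pts Y"
      proof
        fix x assume "x \<in> pts X"
        then have "x = g' (f x)" "f x \<in> pts Y" using g(2) g' fX by simp_all
        then show "x \<in> g' ` pts Y" by blast
      qed
    qed
    show "continuous_map (topo Y) (topo X) g'"
      by (rule continuous_map_eq[OF g(1)]) (simp add: g')
    show "(g' x, g' y) \<in> leq X \<longleftrightarrow> (x, y) \<in> leq Y" "(g' x, g' y) \<in> rel X \<longleftrightarrow> (x, y) \<in> rel Y"
      if "x \<in> pts Y" "y \<in> pts Y" for x y
      using leq[of "g x" "g y"] rel[of "g x" "g y"] that gY g(3) g' by simp_all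
  qed
  moreover have "f \<in> tPS_hom X Y"
    using tPS_hom_of_surj_embedding[OF X Y f surj cont leq rel] by blast
  moreover have "tPS_comp X g' f = tPS_id X" "tPS_comp Y f g' = tPS_id Y"
    using g(2,3) fX g' by (auto simp: tPS_comp_def tPS_id_def compose_def)
  ultimately show ?thesis unfolding tPS_iso_def by blast
qed

section \<open>The points of a space as prime filters\<close>

lemma eps_prime_filter:
  assumes "tPS X" "x \<in> pts X" shows "prime_filter (Psi X) {U \<in> clopen_upsets X. x \<in> U}"
proof -
  interpret tPS X by fact
  have "pts X \<in> {U \<in> clopen_upsets X. x \<in> U}" using assms(2) clopen_upsets_lattice(2) by simp
  moreover have "{} \<in> clopen_upsets X" "{} \<notin> {U \<in> clopen_upsets X. x \<in> U}"
    using clopen_upsets_lattice(1) by auto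
  ultimately show ?thesis
    unfolding prime_filter_def Psi_simps Psi_lle using clopen_upsets_lattice(4) by blast
qed

text \<open>If \<open>S\<close> came from no point, each point would miss some
  \<open>U \<in> S\<close> or lie in some clopen up-set \<open>V \<notin> S\<close>. The sets
  \<open>(pts X - U) \<union> V\<close> would then cover \<open>X\<close>, and by compactness a
  single one would, giving \<open>U \<subseteq> V\<close> against the up-closure of
  \<open>S\<close>.\<close>

lemma prime_filter_Psi_is_eps:
  assumes "tPS X" and S: "prime_filter (Psi X) S"
  shows "\<exists>x\<in>pts X. S = {U \<in> clopen_upsets X. x \<in> U}"
proof (rule ccontr)
  assume no: "\<not> ?thesis"
  interpret tPS X by fact
  interpret L: tDL "Psi X" by (rule Psi_tDL[OF assms(1)])
  note pf = L.prime_filterD[OF S, unfolded Psi_simps Psi_lle]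
  let ?D = "{(pts X - U) \<union> V | U V. U \<in> S \<and> V \<in> clopen_upsets X - S}"
  have "\<exists>W\<in>?D. pts X \<subseteq> W"
  proof (rule closed_subset_directed_open[OF compact closedin_topspace])
    show "openin (topo X) W" if "W \<in> ?D" for W
      using that pf(1) by (fastforce simp: clopen_upsets_def)
    have "{} = (pts X - pts X) \<union> {}" by simp
    then show "{} \<in> ?D" using pf(2,3) clopen_upsets_lattice(1) by blast
    show "W \<union> W' \<in> ?D" if WW: "W \<in> ?D" "W' \<in> ?D" for W W'
    proof -
      obtain U V U' V' where UV: "U \<in> S" "V \<in> clopen_upsets X - S" "W = (pts X - U) \<union> V"
        "U' \<in> S" "V' \<in> clopen_upsets X - S" "W' = (pts X - U') \<union> V'"
        using WW by blast
      then have "U \<inter> U' \<in> S" using pf(1,5) by blast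
      moreover have "V \<union> V' \<in> clopen_upsets X - S"
        using UV(2,5) pf(6) clopen_upsets_lattice(3) by blast
      moreover have "W \<union> W' = (pts X - U \<inter> U') \<union> (V \<union> V')" using UV(3,6) by blast
      ultimately show ?thesis by blast
    qed
    show "\<exists>W\<in>?D. x \<in> W" if x: "x \<in> pts X" for x
    proof -
      have "S \<noteq> {U \<in> clopen_upsets X. x \<in> U}" using no x by blast
      \<comment> \<open>Each case provides one of the two sets; the other is filled in by
        \<open>{}\<close>, which is never in \<open>S\<close>, or by \<open>pts X\<close>, which
        always is.\<close>
      then consider U where "U \<in> S" "x \<notin> U" | V where "V \<in> clopen_upsets X - S" "x \<in> V"
        using pf(1) by blast
      then show ?thesis
      proof cases
        case 1
        then have "(pts X - U) \<union> {} \<in> ?D" "x \<in> (pts X - U) \<union> {}"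
          using x pf(2) clopen_upsets_lattice(1) by blast+
        then show ?thesis by blast
      next
        case 2
        then have "(pts X - pts X) \<union> V \<in> ?D" "x \<in> (pts X - pts X) \<union> V"
          using pf(3) by blast+
        then show ?thesis by blast
      qed
    qed
  qed
  then obtain U V where UV: "U \<in> S" "V \<in> clopen_upsets X" "V \<notin> S" "pts X \<subseteq> (pts X - U) \<union> V"
    by blast
  have "U \<subseteq> V" using UV(1,4) pf(1) clopen_upset_subset by blast
  then show False using UV(1-3) pf(4) by blast
qed

text \<open>By compactness and (tPS1), clopen up-sets detect whether \<open>y\<close> lies above and below members of
  \<open>R(x)\<close>; then \<open>y \<in> R(x)\<close> by (tPS2).\<close>

lemma rel_iff_canon_rel:
  assumes "tPS X" and x: "x \<in> pts X" and y: "y \<in> pts X"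
  shows "canon_rel (Psi X) {U \<in> clopen_upsets X. x \<in> U} {U \<in> clopen_upsets X. y \<in> U} \<longleftrightarrow> (x, y) \<in> rel X"
proof -
  interpret tPS X by fact
  show ?thesis
  proof
    assume "(x, y) \<in> rel X"
    then show "canon_rel (Psi X) {U \<in> clopen_upsets X. x \<in> U} {U \<in> clopen_upsets X. y \<in> U}"
      using x tPS3 by (auto simp: canon_rel_def op_iffs)
  next
    let ?R = "rel X `` {x}"
    assume C: "canon_rel (Psi X) {U \<in> clopen_upsets X. x \<in> U} {U \<in> clopen_upsets X. y \<in> U}"
    have G: "y \<in> U" if "U \<in> clopen_upsets X" "?R \<subseteq> U" for U
      using C that x tPS3(1) unfolding canon_rel_def Psi_simps G_op_def by blast
    have F: "?R \<inter> U \<noteq> {}" if "U \<in> clopen_upsets X" "y \<in> U" for U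
      using C that x tPS3(3) unfolding canon_rel_def Psi_simps F_op_def by blast
    have RX: "z \<in> ?R \<Longrightarrow> z \<in> pts X" for z using rel_on by blast
    \<comment> \<open>Otherwise each \<open>z \<in> ?R\<close> has a clopen up-set containing it and
      not \<open>y\<close>; finitely many cover the closed set \<open>?R\<close>, and their union
      contradicts \<open>G\<close>.\<close>
    have "\<exists>z\<in>?R. (z, y) \<in> leq X"
    proof (rule ccontr)
      assume no: "\<not> ?thesis"
      have "\<exists>U\<in>{U \<in> clopen_upsets X. y \<notin> U}. ?R \<subseteq> U"
      proof (rule closed_subset_directed_open[OF compact tPS1[OF x]])
        show "\<exists>U\<in>{U \<in> clopen_upsets X. y \<notin> U}. z \<in> U" if z: "z \<in> ?R" for z
        proof -
          have "(z, y) \<notin> leq X" using no z by blast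
          then show ?thesis using separation[OF RX[OF z] y] by auto
        qed
        show "openin (topo X) U" if "U \<in> {U \<in> clopen_upsets X. y \<notin> U}" for U
          using that by (simp add: clopen_upsets_def)
      qed (simp_all add: clopen_upsets_lattice)
      then show False using G by blast
    qed
    \<comment> \<open>Dually, finitely many clopen up-sets containing \<open>y\<close> have an
      intersection that misses \<open>?R\<close>, against \<open>F\<close>.\<close>
    moreover have "\<exists>z\<in>?R. (y, z) \<in> leq X"
    proof (rule ccontr)
      assume no: "\<not> ?thesis"
      have "\<exists>U\<in>{U \<in> clopen_upsets X. y \<in> U}. U \<inter> ?R = {}"
      proof (rule closed_disjoint_directed_closed[OF compact tPS1[OF x]])
        show "\<exists>U\<in>{U \<in> clopen_upsets X. y \<in> U}. z \<notin> U" if z: "z \<in> ?R" for z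
        proof -
          have "(y, z) \<notin> leq X" using no z by blast
          then show ?thesis using separation[OF y RX[OF z]] by auto
        qed
        show "closedin (topo X) U" if "U \<in> {U \<in> clopen_upsets X. y \<in> U}" for U
          using that by (simp add: clopen_upsets_def)
      qed (simp_all add: y clopen_upsets_lattice)
      then show False using F by blast
    qed
    ultimately have "y \<in> leq X `` ?R \<inter> (leq X)\<inverse> `` ?R" by blast
    then have "y \<in> ?R" using tPS2[OF x] by blast
    then show "(x, y) \<in> rel X" by blast
  qed
qed

lemma eps_iso:
  assumes "tPS X" shows "eps X \<in> tPS_iso X (Phi (Psi X))"
proof -
  interpret tPS X by fact
  interpret L: tDL "Psi X" by (rule Psi_tDL[OF assms])
  have pf: "S \<in> pts (Phi (Psi X)) \<longleftrightarrow> prime_filter (Psi X) S" for S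
    by (simp add: pts_Phi[OF L.tDL_axioms] prime_filters_def)
  have eq: "x \<in> pts X \<Longrightarrow> eps X x = {U \<in> clopen_upsets X. x \<in> U}" for x
    by (simp add: eps_def)
  note pfX = eps_prime_filter[OF assms]
  show ?thesis
  proof (rule tPS_iso_of_surj_embedding[OF assms Phi_tPS[OF L.tDL_axioms]])
    show ext: "eps X \<in> pts X \<rightarrow>\<^sub>E pts (Phi (Psi X))"
      using pfX by (auto simp: eps_def pf)
    show "eps X ` pts X = pts (Phi (Psi X))"
    proof
      show "pts (Phi (Psi X)) \<subseteq> eps X ` pts X"
      proof
        fix S assume "S \<in> pts (Phi (Psi X))"
        then obtain x where "x \<in> pts X" "S = eps X x"
          using prime_filter_Psi_is_eps[OF assms] eq pf by metis
        then show "S \<in> eps X ` pts X" by blast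
      qed
    qed (use ext in auto)
    let ?B = "sigma_set (Psi X) ` carr (Psi X) \<union>
      (\<lambda>a. prime_filters (Psi X) - sigma_set (Psi X) a) ` carr (Psi X)"
    have "continuous_map (topo X) (topology_generated_by ?B) (eps X)"
    proof (rule continuous_on_generated_topo)
      fix U assume "U \<in> ?B"
      then obtain W where W: "W \<in> clopen_upsets X"
        "U = sigma_set (Psi X) W \<or> U = prime_filters (Psi X) - sigma_set (Psi X) W"
        by auto
      \<comment> \<open>\<open>eps X\<close> pulls each subbasic set back to the clopen up-set that
        names it, or to its complement, whence continuity.\<close>
      have "eps X -` sigma_set (Psi X) W \<inter> pts X = W"
        using W(1) pfX clopen_upset_subset[OF W(1)] by (auto simp: eq sigma_set_iff)
      moreover have "eps X -` (prime_filters (Psi X) - sigma_set (Psi X) W) \<inter> pts X = pts X - W"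
        using W(1) pfX by (auto simp: eq sigma_set_iff prime_filters_def)
      moreover have "openin (topo X) W" "openin (topo X) (pts X - W)"
        using W(1) by (auto simp: clopen_upsets_def)
      ultimately show "openin (topo X) (eps X -` U \<inter> pts X)" using W(2) by auto
    next
      have "\<Union>?B = pts (Phi (Psi X))" by (simp add: Phi_def)
      then show "eps X ` pts X \<subseteq> \<Union>?B" using ext by auto
    qed
    then show "continuous_map (topo X) (topo (Phi (Psi X))) (eps X)" by (simp add: Phi_def)
  next
    fix x y assume xy: "x \<in> pts X" "y \<in> pts X"
    have "{U \<in> clopen_upsets X. x \<in> U} \<subseteq> {U \<in> clopen_upsets X. y \<in> U} \<longleftrightarrow> (x, y) \<in> leq X"
      using separation[OF xy] clopen_upset_leq by blast
    then show "(eps X x, eps X y) \<in> leq (Phi (Psi X)) \<longleftrightarrow> (x, y) \<in> leq X"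
      using xy pfX by (simp add: eq Phi_leq_iff)
    show "(eps X x, eps X y) \<in> rel (Phi (Psi X)) \<longleftrightarrow> (x, y) \<in> rel X"
      using xy pfX rel_iff_canon_rel[OF assms xy] by (simp add: eq Phi_rel_iff)
  qed
qed

section \<open>Functor laws and naturality squares\<close>

lemma Psi_map_id: "tPS X \<Longrightarrow> Psi_map X X (tPS_id X) = tDL_id (Psi X)"
proof -
  assume "tPS X"
  then interpret tPS X .
  show ?thesis
    using clopen_upset_subset by (auto simp: Psi_map_def tPS_id_def tDL_id_def fun_eq_iff)
qed

lemma Psi_map_comp:
  assumes "tPS X" "tPS Y" "f \<in> tPS_hom X Y" "g \<in> tPS_hom Y Z" "tPS Z"
  shows "Psi_map X Z (tPS_comp X g f) = tDL_comp (Psi Z) (Psi_map X Y f) (Psi_map Y Z g)"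
proof
  fix U
  show "Psi_map X Z (tPS_comp X g f) U = tDL_comp (Psi Z) (Psi_map X Y f) (Psi_map Y Z g) U"
  proof (cases "U \<in> clopen_upsets Z")
    case True
    \<comment> \<open>Morphisms are \<open>undefined\<close> off their source, so the inner value
      must be known to lie in the domain of the outer map before the composite unfolds.\<close>
    have "Psi_map Y Z g U \<in> clopen_upsets Y"
      using tDL_homD(4)[OF Psi_map_hom[OF assms(2,5,4)]] True by simp
    then show ?thesis
      using True tPS_homD(3)[OF assms(3)]
      by (auto simp: Psi_map_def tPS_comp_def tDL_comp_def compose_def)
  qed (simp add: Psi_map_def tDL_comp_def compose_def)
qed

lemma Phi_map_id:
  assumes "tDL A" shows "Phi_map A A (tDL_id A) = tPS_id (Phi A)"
proof
  fix S
  have "{a \<in> carr A. tDL_id A a \<in> S} = S" if "S \<in> prime_filters A"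
    using that by (auto simp: prime_filters_def prime_filter_def tDL_id_def)
  then show "Phi_map A A (tDL_id A) S = tPS_id (Phi A) S"
    by (simp add: Phi_map_def tPS_id_def pts_Phi[OF assms])
qed

lemma Phi_map_comp:
  assumes "tDL A" "tDL B" "tDL C" "h \<in> tDL_hom A B" "k \<in> tDL_hom B C"
  shows "Phi_map A C (tDL_comp A k h) = tPS_comp (Phi C) (Phi_map A B h) (Phi_map B C k)"
proof
  fix S
  show "Phi_map A C (tDL_comp A k h) S = tPS_comp (Phi C) (Phi_map A B h) (Phi_map B C k) S"
  proof (cases "prime_filter C S")
    case True
    then show ?thesis
      using prime_filter_preimage[OF assms(2,3,5) True] tDL_homD(4)[OF assms(4)]
      by (auto simp: Phi_map_def tPS_comp_def tDL_comp_def compose_def pts_Phi[OF assms(3)] prime_filters_def)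
  qed (simp add: Phi_map_def tPS_comp_def compose_def pts_Phi[OF assms(3)] prime_filters_def)
qed

text \<open>A prime filter \<open>S\<close> lies in either side at \<open>a\<close> exactly when
  \<open>h a \<in> S\<close>, since this says that the preimage of \<open>S\<close> contains
  \<open>a\<close>.\<close>

lemma sigma_map_natural:
  assumes "tDL A" "tDL B" "h \<in> tDL_hom A B"
  shows "tDL_comp A (sigma_map B) h = tDL_comp A (Psi_map (Phi B) (Phi A) (Phi_map A B h)) (sigma_map A)"
proof
  fix a
  show "tDL_comp A (sigma_map B) h a = tDL_comp A (Psi_map (Phi B) (Phi A) (Phi_map A B h)) (sigma_map A) a"
  proof (cases "a \<in> carr A")
    case True
    have "sigma_set B (h a) = {S \<in> pts (Phi B). Phi_map A B h S \<in> sigma_set A a}"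
      using True prime_filter_preimage[OF assms]
      by (auto simp: sigma_set_iff pts_Phi[OF assms(2)] Phi_map_def prime_filters_def)
    then show ?thesis
      using True tDL_homD(4)[OF assms(3)] sigma_set_clopen_upset[OF assms(1)]
      by (simp add: tDL_comp_def compose_def sigma_map_def Psi_map_def)
  qed (simp add: tDL_comp_def compose_def)
qed

text \<open>Both sides at \<open>x\<close> collect the clopen up-sets \<open>U\<close> with
  \<open>f x \<in> U\<close>, since this says that \<open>x\<close> lies in the preimage of
  \<open>U\<close>.\<close>

lemma eps_natural:
  assumes "tPS X" "tPS Y" "f \<in> tPS_hom X Y"
  shows "tPS_comp X (eps Y) f = tPS_comp X (Phi_map (Psi Y) (Psi X) (Psi_map X Y f)) (eps X)"
proof
  fix x
  show "tPS_comp X (eps Y) f x = tPS_comp X (Phi_map (Psi Y) (Psi X) (Psi_map X Y f)) (eps X) x"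
  proof (cases "x \<in> pts X")
    case True
    have "{U \<in> clopen_upsets X. x \<in> U} \<in> prime_filters (Psi X)"
      using eps_prime_filter[OF assms(1) True] by (simp add: prime_filters_def)
    moreover have "{U \<in> clopen_upsets Y. f x \<in> U} =
        {U \<in> clopen_upsets Y. Psi_map X Y f U \<in> {V \<in> clopen_upsets X. x \<in> V}}"
      using True tDL_homD(4)[OF Psi_map_hom[OF assms]] by (auto simp: Psi_map_def)
    ultimately show ?thesis
      using True tPS_homD(3)[OF assms(3) True]
      by (simp add: tPS_comp_def compose_def eps_def Phi_map_def)
  qed (simp add: tPS_comp_def compose_def)
qed

text \<open>The type variables are schematic, so the objects range over carriers in arbitrary types,
  and a functor law or a naturality square may relate objects over different types.\<close>

theorem theorem3p16:
  shows
    \<comment> \<open>Psi is a contravariant functor from tPS to tDL\<close>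
    "(\<forall>X :: 'x tense_space. tPS X \<longrightarrow> tDL (Psi X)) \<and>
     (\<forall>(X :: 'x tense_space) (Y :: 'y tense_space) f.
        tPS X \<and> tPS Y \<and> f \<in> tPS_hom X Y \<longrightarrow> Psi_map X Y f \<in> tDL_hom (Psi Y) (Psi X)) \<and>
     (\<forall>X :: 'x tense_space. tPS X \<longrightarrow> Psi_map X X (tPS_id X) = tDL_id (Psi X)) \<and>
     (\<forall>(X :: 'x tense_space) (Y :: 'y tense_space) (Z :: 'z tense_space) f g.
        tPS X \<and> tPS Y \<and> tPS Z \<and> f \<in> tPS_hom X Y \<and> g \<in> tPS_hom Y Z \<longrightarrow>
        Psi_map X Z (tPS_comp X g f) = tDL_comp (Psi Z) (Psi_map X Y f) (Psi_map Y Z g)) \<and>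
     \<comment> \<open>Phi is a contravariant functor from tDL to tPS\<close>
     (\<forall>A :: 'a tense_lattice. tDL A \<longrightarrow> tPS (Phi A)) \<and>
     (\<forall>(A :: 'a tense_lattice) (B :: 'b tense_lattice) h.
        tDL A \<and> tDL B \<and> h \<in> tDL_hom A B \<longrightarrow> Phi_map A B h \<in> tPS_hom (Phi B) (Phi A)) \<and>
     (\<forall>A :: 'a tense_lattice. tDL A \<longrightarrow> Phi_map A A (tDL_id A) = tPS_id (Phi A)) \<and>
     (\<forall>(A :: 'a tense_lattice) (B :: 'b tense_lattice) (C :: 'c tense_lattice) h k.
        tDL A \<and> tDL B \<and> tDL C \<and> h \<in> tDL_hom A B \<and> k \<in> tDL_hom B C \<longrightarrow>
        Phi_map A C (tDL_comp A k h) = tPS_comp (Phi C) (Phi_map A B h) (Phi_map B C k)) \<and>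
     \<comment> \<open>sigma_map is a natural isomorphism from the identity of tDL to Psi after Phi\<close>
     (\<forall>A :: 'a tense_lattice. tDL A \<longrightarrow> sigma_map A \<in> tDL_iso A (Psi (Phi A))) \<and>
     (\<forall>(A :: 'a tense_lattice) (B :: 'b tense_lattice) h.
        tDL A \<and> tDL B \<and> h \<in> tDL_hom A B \<longrightarrow>
        tDL_comp A (sigma_map B) h
          = tDL_comp A (Psi_map (Phi B) (Phi A) (Phi_map A B h)) (sigma_map A)) \<and>
     \<comment> \<open>eps is a natural isomorphism from the identity of tPS to Phi after Psi\<close>
     (\<forall>X :: 'x tense_space. tPS X \<longrightarrow> eps X \<in> tPS_iso X (Phi (Psi X))) \<and>
     (\<forall>(X :: 'x tense_space) (Y :: 'y tense_space) f.
        tPS X \<and> tPS Y \<and> f \<in> tPS_hom X Y \<longrightarrow>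
        tPS_comp X (eps Y) f
          = tPS_comp X (Phi_map (Psi Y) (Psi X) (Psi_map X Y f)) (eps X))"
  by (intro conjI allI impI; (elim conjE)?)
    (simp_all only: Psi_tDL Psi_map_hom Psi_map_id Psi_map_comp Phi_tPS Phi_map_hom Phi_map_id
      Phi_map_comp sigma_map_iso sigma_map_natural eps_iso eps_natural)

end
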